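(* Let $n,d\ge1$ be integers and let $B^n\subset\mathbb{R}^n$ be the closed unit ball. Let $f:B^n\to\mathbb{R}$ be a $C^{d+1}$-smooth function with $M_0(f)=1$, such that $f$ does not vanish outside the concentric ball $B^n_{1/2}$ of radius $\frac12$, and such that for a certain $\gamma$ with $0<\gamma<1$, zero is a $\gamma$-regular value of $f$. Let $Y_0(f)=\{x\in B^n: f(x)=0\}$ (a compact smooth hypersurface in $B^n_{1/2}$) and let $V_i$, $i=1,\dots,q$, be its connected components. Let $P$ be the Taylor polynomial of $f$ of degree $d$ at the origin, and let $Y_0(P)=\{x\in B^n:P(x)=0\}$ be its zero set. Put $$T=T(\gamma)=\min\left\{1,\frac{d!\,\gamma^2}{4C_3}\right\},$$ where $C_3=C_3(n,d)$ is the constant defined in the context. If $M_{d+1}(f)\le T$, then the smooth hypersurface $Y_0(f)=\bigcup_{i=1}^q V_i$ is smoothly isotopic to a certain union $W=\bigcup_{i=1}^q W_i$ of smooth connected components $W_i$ of the algebraic hypersurface $Y_0(P)$.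
   Context: For a $C^{d+1}$ function $f:B^n\to\mathbb{R}$ and $l=0,1,\dots,d+1$, $M_l(f)=\max_{z\in B^n}\|f^{(l)}(z)\|$, where the norm of the $l$-th derivative is the sum of the absolute values of all partial derivatives of $f$ of order $l$. For $\gamma>0$, a real number $c$ is a $\gamma$-regular value of $f$ if $\|\operatorname{grad} f(x)\|\ge\gamma$ for each $x\in B^n$ with $f(x)=c$. Constants: let $\bar C(n,d)$ be a fixed constant such that $M_k(P)\le\bar C(n,d)M_0(P)$ for all real polynomials $P$ of degree at most $d$ in $n$ variables and all $k=1,\dots,d$ (it exists by equivalence of norms on a finite-dimensional space). Put $C_1(n,d)=\bar C(n,d)$, $C_2(n,d)=\frac{\bar C(n,d)}{(d+1)!}+1$, so that $M_k(f)\le C_1(n,d)M_0(f)+C_2(n,d)M_{d+1}(f)$ for every $C^{d+1}$ function $f$ on $B^n$ and all $k=1,\dots,d$; and $C_3(n,d)=C_1(n,d)+C_2(n,d)$. *)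

theory Defs
  imports "HOL-Analysis.Analysis"
begin

section \<open>Differentiability classes and partial derivatives\<close>

text \<open>
  Derivatives are Frechet derivatives relative to the set \<open>S\<close>. They are uniquely
  determined, and depend only on the values of the function on \<open>S\<close>, when \<open>S\<close> is open or
  a convex set with nonempty interior; only open sets and the closed unit ball are used below.
  The partial derivative is read off the Frechet derivative, not off a limit along
  the line \<open>x + t b\<close>, which may meet the closed ball in \<open>x\<close> only when \<open>x\<close> is on the boundary.
\<close>

definition partial_deriv ::
    "'a::euclidean_space set \<Rightarrow> 'a \<Rightarrow> ('a \<Rightarrow> 'b::real_normed_vector) \<Rightarrow> 'a \<Rightarrow> 'b" where
  "partial_deriv S b f x = frechet_derivative f (at x within S) b"

primrec Ck_on ::
    "nat \<Rightarrow> 'a::euclidean_space set \<Rightarrow> ('a \<Rightarrow> 'b::real_normed_vector) \<Rightarrow> bool" where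
  "Ck_on 0 S f \<longleftrightarrow> continuous_on S f"
| "Ck_on (Suc k) S f \<longleftrightarrow>
     f differentiable_on S \<and> (\<forall>b\<in>Basis. Ck_on k S (partial_deriv S b f))"

primrec iter_partial ::
    "'a::euclidean_space set \<Rightarrow> 'a list \<Rightarrow> ('a \<Rightarrow> 'b::real_normed_vector) \<Rightarrow> 'a \<Rightarrow> 'b" where
  "iter_partial S [] f = f"
| "iter_partial S (b # bs) f = partial_deriv S b (iter_partial S bs f)"

definition grad_on :: "'a::euclidean_space set \<Rightarrow> ('a \<Rightarrow> real) \<Rightarrow> 'a \<Rightarrow> 'a" where
  "grad_on S f x = (\<Sum>b\<in>Basis. partial_deriv S b f x *\<^sub>R b)"

definition multi_dirs :: "nat \<Rightarrow> 'a::euclidean_space list set" where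
  "multi_dirs l = {bs. set bs \<subseteq> Basis \<and> length bs = l}"

text \<open>
  The norm of the \<open>l\<close>-th derivative is the sum of the absolute values of the entries
  \<open>\<partial>\<^sup>l f / \<partial>x\<^bsub>i1\<^esub> \<dots> \<partial>x\<^bsub>il\<^esub>\<close>, over all tuples \<open>(i1, \<dots>, il)\<close>. With this count the Taylor
  remainder of degree \<open>d\<close> at the origin is bounded by \<open>M (d + 1) f / (d + 1)!\<close>, as the
  constant \<open>C2\<close> below presupposes; if mixed derivatives that differ only in the order of
  differentiation were counted once, that bound would fail (\<open>f = x y z\<close>, \<open>d = 2\<close>).
  The supremum is a maximum for functions of class \<open>C\<^sup>l\<close>.
\<close>

definition M :: "nat \<Rightarrow> ('a::euclidean_space \<Rightarrow> real) \<Rightarrow> real" where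
  "M l f = (SUP z\<in>cball 0 1. \<Sum>bs\<in>multi_dirs l. \<bar>iter_partial (cball 0 1) bs f z\<bar>)"

section \<open>Polynomials and constants\<close>

definition poly_deg_le :: "nat \<Rightarrow> (real ^ 'n \<Rightarrow> real) \<Rightarrow> bool" where
  "poly_deg_le d P \<longleftrightarrow>
     (\<exists>c. P = (\<lambda>x. \<Sum>\<alpha> | (\<Sum>i\<in>UNIV. \<alpha> i) \<le> d. c \<alpha> * (\<Prod>i\<in>UNIV. (x $ i) ^ \<alpha> i)))"

text \<open>
  The Taylor polynomial at the origin, \<open>\<Sum>k\<le>d. D\<^sup>k f(0)(x, \<dots>, x) / k!\<close>. Summing over tuples of
  directions, each monomial occurs with the multinomial factor that turns \<open>1 / k!\<close> into
  \<open>1 / \<alpha>!\<close>.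
\<close>

definition taylor_poly :: "nat \<Rightarrow> ('a::euclidean_space \<Rightarrow> real) \<Rightarrow> 'a \<Rightarrow> real" where
  "taylor_poly d f x =
     (\<Sum>k\<le>d. (\<Sum>bs\<in>multi_dirs k.
        iter_partial (cball 0 1) bs f 0 * (\<Prod>b\<leftarrow>bs. x \<bullet> b)) / fact k)"

text \<open>\<open>C\<close> is an admissible value of the constant written \<open>C\<close>-bar for the dimension \<open>CARD('n)\<close>.\<close>

definition poly_deriv_bound :: "'n::finite itself \<Rightarrow> nat \<Rightarrow> real \<Rightarrow> bool" where
  "poly_deriv_bound _ d C \<longleftrightarrow>
     (\<forall>P :: real ^ 'n \<Rightarrow> real. poly_deg_le d P \<longrightarrow> (\<forall>k\<in>{1..d}. M k P \<le> C * M 0 P))"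

definition C1 :: "real \<Rightarrow> real" where
  "C1 C = C"

definition C2 :: "nat \<Rightarrow> real \<Rightarrow> real" where
  "C2 d C = C / fact (d + 1) + 1"

definition C3 :: "nat \<Rightarrow> real \<Rightarrow> real" where
  "C3 d C = C1 C + C2 d C"

section \<open>Zero sets, hypersurfaces and isotopies\<close>

definition Y0 :: "('a::euclidean_space \<Rightarrow> real) \<Rightarrow> 'a set" where
  "Y0 f = {x \<in> cball 0 1. f x = 0}"

definition regular_value :: "real \<Rightarrow> ('a::euclidean_space \<Rightarrow> real) \<Rightarrow> real \<Rightarrow> bool" where
  "regular_value \<gamma> f c \<longleftrightarrow> (\<forall>x\<in>cball 0 1. f x = c \<longrightarrow> norm (grad_on (cball 0 1) f x) \<ge> \<gamma>)"

definition Ck_hypersurface :: "nat \<Rightarrow> 'a::euclidean_space set \<Rightarrow> bool" where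
  "Ck_hypersurface k S \<longleftrightarrow>
     (\<forall>x\<in>S. \<exists>U g. open U \<and> x \<in> U \<and> Ck_on k U (g :: 'a \<Rightarrow> real) \<and>
        S \<inter> U = {y \<in> U. g y = 0} \<and> (\<forall>y\<in>S \<inter> U. grad_on U g y \<noteq> 0))"

text \<open>
  A map on an arbitrary subset of a Euclidean space is of class \<open>C\<^sup>k\<close> if it is the restriction
  of a \<open>C\<^sup>k\<close> map on an open neighbourhood.
\<close>

definition Ck_map ::
    "nat \<Rightarrow> 'a::euclidean_space set \<Rightarrow> ('a \<Rightarrow> 'b::real_normed_vector) \<Rightarrow> bool" where
  "Ck_map k S f \<longleftrightarrow> (\<exists>U F. open U \<and> S \<subseteq> U \<and> Ck_on k U F \<and> (\<forall>x\<in>S. F x = f x))"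

definition Ck_diffeo ::
    "nat \<Rightarrow> ('a::euclidean_space \<Rightarrow> 'b::euclidean_space) \<Rightarrow> 'a set \<Rightarrow> 'b set \<Rightarrow> bool" where
  "Ck_diffeo k h S T \<longleftrightarrow>
     bij_betw h S T \<and> Ck_map k S h \<and> Ck_map k T (inv_into S h)"

text \<open>
  Isotopy of submanifolds \<open>V\<close>, \<open>W\<close> of \<open>A\<close>: a \<open>C\<^sup>k\<close> family of embeddings of \<open>V\<close> in \<open>A\<close>
  that starts with the inclusion and ends with an embedding onto \<open>W\<close>.
\<close>

definition Ck_isotopic ::
    "nat \<Rightarrow> 'a::euclidean_space set \<Rightarrow> 'a set \<Rightarrow> 'a set \<Rightarrow> bool" where
  "Ck_isotopic k A V W \<longleftrightarrow>
     (\<exists>H :: real \<Rightarrow> 'a \<Rightarrow> 'a.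
        Ck_map k ({0..1} \<times> V) (\<lambda>(t, x). H t x) \<and>
        (\<forall>t\<in>{0..1}. H t ` V \<subseteq> A \<and> Ck_diffeo k (H t) V (H t ` V)) \<and>
        (\<forall>x\<in>V. H 0 x = x) \<and> H 1 ` V = W)"

end

theory Submission
  imports Defs
begin

text \<open>
  Write \<open>\<nu>\<close> for the gradient of the Taylor polynomial \<open>P\<close>. Taylor's formula and the bound on
  \<open>M (d + 1) f\<close> make \<open>f - P\<close> at most \<open>\<gamma>\<^sup>2 / (8 * C3)\<close> and the difference of the gradients at most
  \<open>\<gamma> / 8\<close> in the unit ball, while \<open>C3\<close> bounds the Hessian of \<open>P\<close>. Hence every zero \<open>x\<close> of \<open>f\<close> has
  a nearest zero \<open>y\<close> of \<open>P\<close> at distance at most \<open>\<gamma> / (4 * C3)\<close>, and \<open>x = y + s \<nu>(y)\<close> for some \<open>s\<close>.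
  In the range of \<open>(y, s)\<close> that matters, \<open>(y, s) \<mapsto> (y + s \<nu>(y), P y)\<close> and
  \<open>(y, s) \<mapsto> (y, f (y + s \<nu>(y)))\<close> are injective with injective derivatives. The inverse of the first
  gives a projection \<open>\<pi>\<close> of the zero set of \<open>f\<close> into that of \<open>P\<close>, the inverse of the second the map
  \<open>\<epsilon>\<close> back along the normals. The isotopy slides each \<open>x\<close> linearly to \<open>\<pi> x\<close>; since \<open>\<epsilon>\<close> is defined
  on an open set, the image of \<open>\<pi>\<close> is open in the zero set of \<open>P\<close>, and it is compact, so it is a union
  of components.
\<close>

section \<open>Calculus of the classes \<open>C\<^sup>k\<close>\<close>

text \<open>The choice of normals decides the smoothness of the isotopy. The gradient of f is only
  of class C^d, so projecting along the normals of the zero set of f, or following a flow built from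
  that gradient, would in general lose one derivative. The normals of P are polynomial and f enters
  the construction only through its values, so class C^(d+1) is kept. No charts on the hypersurfaces
  are used. One extra real parameter, paired with one extra real value, turns both constructions
  into maps between open sets of the same dimension, where invariance of domain and the inverse
  function theorem apply. Away from its zeros f has no lower bound, so P may have further zeros in
  the ball. The two zero sets therefore cannot be matched completely, and an open-closed argument
  singles out the components that are reached.\<close>

text \<open>Open sets and closed balls are solid; on a solid set Frechet derivatives are unique.\<close>

definition solid :: "'a::real_normed_vector set \<Rightarrow> bool" where
  "solid S \<longleftrightarrow> (\<forall>x\<in>S. \<exists>z r. r > 0 \<and> (\<forall>y\<in>ball z r. closed_segment x y \<subseteq> S))"

lemma solid_open:
  assumes "open S" shows "solid S"
  unfolding solid_def
proof
  fix x assume "x \<in> S"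
  then obtain r where r: "r > 0" "ball x r \<subseteq> S"
    using assms open_contains_ball by blast
  have "closed_segment x y \<subseteq> S" if "y \<in> ball x r" for y
    using closed_segment_subset[of x "ball x r" y] that r by auto
  then show "\<exists>z r. r > 0 \<and> (\<forall>y\<in>ball z r. closed_segment x y \<subseteq> S)"
    using r by blast
qed

lemma solid_cball: "r > 0 \<Longrightarrow> solid (cball z r)"
  unfolding solid_def
  by (metis ball_subset_cball closed_segment_subset convex_cball subsetD)

text \<open>On each segment from \<open>x\<close> into the ball both maps give the one-sided
  derivative of the same function of one variable. They thus agree on \<open>y - x\<close> for all
  \<open>y\<close> in an open ball, and differences of such vectors, rescaled, give every direction.
  The point \<open>x\<close> itself may lie on the boundary.\<close>

lemma has_derivative_unique_solid:
  fixes f :: "'a::real_normed_vector \<Rightarrow> 'b::real_normed_vector"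
  assumes "solid S" "x \<in> S"
    and A: "(f has_derivative A) (at x within S)" and B: "(f has_derivative B) (at x within S)"
  shows "A = B"
proof -
  obtain z r where r: "r > 0" and seg: "\<And>y. y \<in> ball z r \<Longrightarrow> closed_segment x y \<subseteq> S"
    using assms(1,2) unfolding solid_def by blast
  interpret A: bounded_linear A using A by (rule has_derivative_bounded_linear)
  interpret B: bounded_linear B using B by (rule has_derivative_bounded_linear)
  have AB: "A (y - x) = B (y - x)" if "y \<in> ball z r" for y
  proof -
    have img: "(\<lambda>t. x + t *\<^sub>R (y - x)) ` {0..1} \<subseteq> S"
    proof
      fix w assume "w \<in> (\<lambda>t. x + t *\<^sub>R (y - x)) ` {0..1}"
      then obtain t where "0 \<le> t" "t \<le> 1" "w = (1 - t) *\<^sub>R x + t *\<^sub>R y"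
        by (auto simp: algebra_simps)
      then have "w \<in> closed_segment x y" unfolding in_segment by blast
      then show "w \<in> S" using seg[OF that] by blast
    qed
    have l: "((\<lambda>t::real. x + t *\<^sub>R (y - x)) has_derivative (\<lambda>t. t *\<^sub>R (y - x))) (at 0 within {0..1})"
      by (auto intro!: derivative_eq_intros)
    have *: "((\<lambda>t. f (x + t *\<^sub>R (y - x))) has_vector_derivative D (y - x)) (at 0 within cbox 0 1)"
      if D: "(f has_derivative D) (at x within S)" for D
    proof -
      interpret D: bounded_linear D using D by (rule has_derivative_bounded_linear)
      have "((\<lambda>t. f (x + t *\<^sub>R (y - x))) has_derivative (\<lambda>t. D (t *\<^sub>R (y - x)))) (at 0 within {0..1})"
        by (rule has_derivative_in_compose[OF l]) (use has_derivative_subset[OF D img] in simp)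
      then show ?thesis by (simp add: has_vector_derivative_def D.scaleR)
    qed
    show ?thesis
      by (rule vector_derivative_unique_within_closed_interval[OF _ _ *[OF A] *[OF B]]) auto
  qed
  show ?thesis
  proof
    fix h :: 'a
    define c where "c = r / (2 * (norm h + 1))"
    have c: "c > 0" using r by (simp add: c_def add_nonneg_pos)
    have "c * norm h < r"
      using r by (simp add: c_def divide_simps add_nonneg_pos)
    then have "z + c *\<^sub>R h \<in> ball z r" using c by (simp add: dist_norm)
    from AB[OF this] AB[of z] r have "A (c *\<^sub>R h + (z - x)) = B (c *\<^sub>R h + (z - x))" "A (z - x) = B (z - x)"
      by (simp_all add: algebra_simps)
    then have "c *\<^sub>R A h = c *\<^sub>R B h"
      unfolding A.add B.add A.scaleR B.scaleR by simp
    then show "A h = B h" using c by simp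
  qed
qed

section \<open>Partial derivatives and the classes C^k on solid sets\<close>

lemma partial_deriv_eq:
  assumes "solid S" "x \<in> S" "(f has_derivative D) (at x within S)"
  shows "partial_deriv S b f x = D b"
  using has_derivative_unique_solid[OF assms(1,2) assms(3)] assms(3)
  unfolding partial_deriv_def frechet_derivative_def by (metis someI_ex)

lemma has_derivative_partial:
  assumes "f differentiable_on S" "x \<in> S"
  shows "(f has_derivative (\<lambda>h. \<Sum>b\<in>Basis. (h \<bullet> b) *\<^sub>R partial_deriv S b f x)) (at x within S)"
proof -
  let ?D = "frechet_derivative f (at x within S)"
  have D: "(f has_derivative ?D) (at x within S)"
    using assms frechet_derivative_works unfolding differentiable_on_def by blast
  then interpret bounded_linear ?D by (rule has_derivative_bounded_linear)
  have "?D h = (\<Sum>b\<in>Basis. (h \<bullet> b) *\<^sub>R partial_deriv S b f x)" for h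
  proof -
    have "?D h = ?D (\<Sum>b\<in>Basis. (h \<bullet> b) *\<^sub>R b)" by (simp add: euclidean_representation)
    then show ?thesis by (simp add: sum scaleR partial_deriv_def)
  qed
  then have "?D = (\<lambda>h. \<Sum>b\<in>Basis. (h \<bullet> b) *\<^sub>R partial_deriv S b f x)" ..
  with D show ?thesis by simp
qed

lemma has_derivative_cong_on:
  assumes "\<And>x. x \<in> S \<Longrightarrow> f x = g x" "x \<in> S"
  shows "(f has_derivative D) (at x within S) \<longleftrightarrow> (g has_derivative D) (at x within S)"
  using assms has_derivative_transform[of x S f g] has_derivative_transform[of x S g f] by metis

lemma partial_deriv_cong:
  assumes "\<And>x. x \<in> S \<Longrightarrow> f x = g x" "x \<in> S"
  shows "partial_deriv S b f x = partial_deriv S b g x"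
  unfolding partial_deriv_def frechet_derivative_def
  using has_derivative_cong_on[of S f g x] assms by simp

lemma Ck_on_cong:
  assumes "\<And>x. x \<in> S \<Longrightarrow> f x = g x"
  shows "Ck_on k S f \<longleftrightarrow> Ck_on k S g"
  using assms
proof (induction k arbitrary: f g)
  case 0
  then show ?case by (auto cong: continuous_on_cong)
next
  case (Suc k)
  have "f differentiable_on S \<longleftrightarrow> g differentiable_on S"
    unfolding differentiable_on_def differentiable_def
    using has_derivative_cong_on[of S f g] Suc.prems by auto
  moreover have "Ck_on k S (partial_deriv S b f) \<longleftrightarrow> Ck_on k S (partial_deriv S b g)" for b
    by (rule Suc.IH) (rule partial_deriv_cong[OF Suc.prems])
  ultimately show ?case by simp
qed

text \<open>Uniqueness on solid sets lets any explicitly known derivative stand in for the chosen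
  \<open>frechet_derivative\<close>. The closure properties of C^k use this as their induction
  step.\<close>

lemma Ck_on_SucI:
  assumes "solid S"
    and D: "\<And>x. x \<in> S \<Longrightarrow> (f has_derivative D x) (at x within S)"
    and "\<And>b. b \<in> Basis \<Longrightarrow> Ck_on k S (\<lambda>x. D x b)"
  shows "Ck_on (Suc k) S f"
proof -
  have "f differentiable_on S" unfolding differentiable_on_def differentiable_def using D by blast
  moreover have "Ck_on k S (partial_deriv S b f)" if "b \<in> Basis" for b
    using assms(3)[OF that] Ck_on_cong[of S "partial_deriv S b f" "\<lambda>x. D x b" k]
      partial_deriv_eq[OF assms(1) _ D] by simp
  ultimately show ?thesis by simp
qed

lemma Ck_on_continuous: "Ck_on k S f \<Longrightarrow> continuous_on S f"
  by (cases k) (auto intro: differentiable_imp_continuous_on)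

lemma Ck_on_SucD: "Ck_on (Suc k) S f \<Longrightarrow> Ck_on k S f"
  by (induction k arbitrary: f) (auto intro: differentiable_imp_continuous_on)

lemma Ck_on_mono: "Ck_on k S f \<Longrightarrow> j \<le> k \<Longrightarrow> Ck_on j S f"
  by (induction k) (auto simp: le_Suc_eq simp del: Ck_on.simps(2) dest: Ck_on_SucD)

lemma Ck_on_Suc_has_derivative:
  assumes "Ck_on (Suc k) S f" "x \<in> S"
  shows "(f has_derivative (\<lambda>h. \<Sum>b\<in>Basis. (h \<bullet> b) *\<^sub>R partial_deriv S b f x)) (at x within S)"
  by (rule has_derivative_partial) (use assms in auto)

lemma partial_deriv_subset:
  assumes "solid S" "S \<subseteq> T" "f differentiable_on T" "x \<in> S" "b \<in> Basis"
  shows "partial_deriv S b f x = partial_deriv T b f x"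
proof -
  have "partial_deriv S b f x = (\<Sum>c\<in>Basis. (b \<bullet> c) *\<^sub>R partial_deriv T c f x)"
    by (rule partial_deriv_eq[OF assms(1,4) has_derivative_subset[OF has_derivative_partial]])
      (use assms in auto)
  also have "\<dots> = (\<Sum>c\<in>Basis. if c = b then partial_deriv T c f x else 0)"
    by (rule sum.cong) (use assms in \<open>auto simp: inner_Basis\<close>)
  finally show ?thesis using assms by simp
qed

lemma Ck_on_subset:
  assumes "solid S" "S \<subseteq> T" "Ck_on k T f"
  shows "Ck_on k S f"
  using assms(3)
proof (induction k arbitrary: f)
  case 0
  then show ?case using assms by (auto intro: continuous_on_subset)
next
  case (Suc k)
  then have d: "f differentiable_on T" by simp
  have "Ck_on k S (partial_deriv S b f)" if "b \<in> Basis" for b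
    using Ck_on_cong[of S "partial_deriv S b f" "partial_deriv T b f" k]
      partial_deriv_subset[OF assms(1,2) d _ that] Suc that by simp
  then show ?case using d assms(2) differentiable_on_subset by auto
qed

text \<open>The two claims are proved together: passing from \<open>T\<close> to \<open>S\<close> in
  one more direction requires the previous iterated derivative to be differentiable on
  \<open>T\<close>, which the second claim supplies.\<close>

lemma iter_partial_subset:
  assumes "solid S" "S \<subseteq> T" "Ck_on k T f" "set bs \<subseteq> Basis" "length bs \<le> k" "x \<in> S"
  shows "iter_partial S bs f x = iter_partial T bs f x"
    and "Ck_on (k - length bs) T (iter_partial T bs f)"
  using assms(4-6)
proof (induction bs arbitrary: x)
  case Nil
  {
    case 1
    show ?case by simp
  next
    case 2
    show ?case using assms by simp
  }
next
  case (Cons b bs)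
  have s: "k - length bs = Suc (k - length (b # bs))" if "length (b # bs) \<le> k"
    using that by simp
  {
    case 1
    have d: "iter_partial T bs f differentiable_on T"
      using Cons.IH(2)[of x] 1 s by simp
    have "iter_partial S (b # bs) f x = partial_deriv S b (iter_partial T bs f) x"
      using partial_deriv_cong[of S "iter_partial S bs f" "iter_partial T bs f" x b] Cons.IH(1) 1 by simp
    also have "\<dots> = partial_deriv T b (iter_partial T bs f) x"
      by (rule partial_deriv_subset[OF assms(1,2) d]) (use 1 in auto)
    finally show ?case by simp
  next
    case 2
    then show ?case using Cons.IH(2)[of x] s by simp
  }
qed

section \<open>Closure properties of the classes C^k\<close>

lemma Ck_on_const: "solid S \<Longrightarrow> Ck_on k S (\<lambda>_. c)"
proof (induction k arbitrary: c)
  case (Suc k)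
  then show ?case by (intro Ck_on_SucI[where D = "\<lambda>_ _. 0"]) (auto intro!: derivative_eq_intros)
qed (simp add: continuous_on_const)

lemma Ck_on_bounded_linear:
  assumes "solid S" "bounded_linear L" "Ck_on k S f"
  shows "Ck_on k S (\<lambda>x. L (f x))"
  using assms(3)
proof (induction k arbitrary: f)
  case 0
  then show ?case using bounded_linear.continuous_on[OF assms(2)] by simp
next
  case (Suc k)
  interpret bounded_linear L by fact
  show ?case
    by (rule Ck_on_SucI[OF assms(1) bounded_linear.has_derivative[OF assms(2)
            Ck_on_Suc_has_derivative[OF Suc.prems]]])
      (use Suc in \<open>auto simp: inner_Basis if_distrib if_distribR sum.If_cases cong: if_cong\<close>)
qed

lemma Ck_on_id: "solid S \<Longrightarrow> Ck_on k S (\<lambda>x. x)"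
  by (cases k) (auto intro!: Ck_on_SucI Ck_on_const derivative_eq_intros simp del: Ck_on.simps(2))

lemma Ck_on_linear: "solid S \<Longrightarrow> bounded_linear L \<Longrightarrow> Ck_on k S L"
  using Ck_on_bounded_linear[OF _ _ Ck_on_id] by blast

lemma sum_inner_Basis_scaleR:
  fixes F :: "'a::euclidean_space \<Rightarrow> 'b::real_vector"
  assumes "b \<in> Basis"
  shows "(\<Sum>c\<in>Basis. (b \<bullet> c) *\<^sub>R F c) = F b"
proof -
  have "(\<Sum>c\<in>Basis. (b \<bullet> c) *\<^sub>R F c) = (\<Sum>c\<in>Basis. if c = b then F c else 0)"
    by (rule sum.cong) (use assms in \<open>auto simp: inner_Basis\<close>)
  then show ?thesis using assms by simp
qed

lemma Ck_on_add:
  assumes "solid S" "Ck_on k S f" "Ck_on k S g"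
  shows "Ck_on k S (\<lambda>x. f x + g x)"
  using assms(2,3)
proof (induction k arbitrary: f g)
  case 0
  then show ?case by (auto intro: continuous_intros)
next
  case (Suc k)
  show ?case
    by (rule Ck_on_SucI[OF assms(1) has_derivative_add[OF Ck_on_Suc_has_derivative[OF Suc.prems(1)]
          Ck_on_Suc_has_derivative[OF Suc.prems(2)]]])
      (use Suc in \<open>auto simp: sum_inner_Basis_scaleR\<close>)
qed

lemma Ck_on_bilinear:
  assumes "solid S" "bounded_bilinear bop" "Ck_on k S f" "Ck_on k S g"
  shows "Ck_on k S (\<lambda>x. bop (f x) (g x))"
  using assms(3,4)
proof (induction k arbitrary: f g)
  case 0
  then show ?case using bounded_bilinear.continuous_on[OF assms(2)] by auto
next
  case (Suc k)
  interpret bounded_bilinear bop by fact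
  show ?case
    by (rule Ck_on_SucI[OF assms(1) FDERIV[OF Ck_on_Suc_has_derivative[OF Suc.prems(1)]
          Ck_on_Suc_has_derivative[OF Suc.prems(2)]]])
      (use Suc Ck_on_SucD[OF Suc.prems(1)] Ck_on_SucD[OF Suc.prems(2)] in
        \<open>auto simp: sum_inner_Basis_scaleR intro!: Ck_on_add assms(1)\<close>)
qed

lemmas Ck_on_scaleR = Ck_on_bilinear[OF _ bounded_bilinear_scaleR]
lemmas Ck_on_mult = Ck_on_bilinear[OF _ bounded_bilinear_mult]
lemmas Ck_on_minus = Ck_on_bounded_linear[OF _ bounded_linear_minus[OF bounded_linear_ident]]

lemma Ck_on_diff:
  assumes "solid S" "Ck_on k S f" "Ck_on k S g"
  shows "Ck_on k S (\<lambda>x. f x - g x)"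
  using Ck_on_add[OF assms(1,2) Ck_on_minus[OF assms(1,3)]] by simp

lemma Ck_on_sum:
  assumes "solid S" "\<And>i. i \<in> I \<Longrightarrow> Ck_on k S (f i)"
  shows "Ck_on k S (\<lambda>x. \<Sum>i\<in>I. f i x)"
  using assms(2)
  by (induction I rule: infinite_finite_induct) (auto intro: Ck_on_const Ck_on_add assms(1))

lemma Ck_on_Pair:
  assumes "solid S" "Ck_on k S f" "Ck_on k S g"
  shows "Ck_on k S (\<lambda>x. (f x, g x))"
proof -
  have "Ck_on k S (\<lambda>x. (f x, 0) + (0, g x))"
    using Ck_on_bounded_linear[OF assms(1) bounded_linear_Pair[OF bounded_linear_ident bounded_linear_zero] assms(2)]
      Ck_on_bounded_linear[OF assms(1) bounded_linear_Pair[OF bounded_linear_zero bounded_linear_ident] assms(3)]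
    by (rule Ck_on_add[OF assms(1)])
  then show ?thesis by simp
qed

lemma Ck_on_compose:
  assumes "solid S" "solid T" "Ck_on k T g" "Ck_on k S f" "f ` S \<subseteq> T"
  shows "Ck_on k S (\<lambda>x. g (f x))"
  using assms(3,4)
proof (induction k arbitrary: g)
  case 0
  then show ?case using assms(5) continuous_on_compose2 by auto
next
  case (Suc k)
  let ?Df = "\<lambda>x h. \<Sum>b\<in>Basis. (h \<bullet> b) *\<^sub>R partial_deriv S b f x"
  show ?case
  proof (rule Ck_on_SucI[OF assms(1)])
    fix x assume x: "x \<in> S"
    show "((\<lambda>x. g (f x)) has_derivative
        (\<lambda>h. \<Sum>c\<in>Basis. (?Df x h \<bullet> c) *\<^sub>R partial_deriv T c g (f x))) (at x within S)"
      by (rule has_derivative_in_compose[OF Ck_on_Suc_has_derivative[OF Suc.prems(2) x]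
            has_derivative_subset[OF Ck_on_Suc_has_derivative[OF Suc.prems(1)] assms(5)]])
        (use x assms(5) in auto)
  next
    fix b :: 'a assume b: "b \<in> Basis"
    have 1: "Ck_on k S (\<lambda>x. partial_deriv T c g (f x))" if "c \<in> Basis" for c
      using Suc.IH[of "partial_deriv T c g"] Suc.prems(1) that Ck_on_SucD[OF Suc.prems(2)] by simp
    have 2: "Ck_on k S (\<lambda>x. partial_deriv S b f x \<bullet> c)" for c
      by (rule Ck_on_bounded_linear[OF assms(1) bounded_linear_inner_left])
        (use Suc.prems(2) b in simp)
    show "Ck_on k S (\<lambda>x. \<Sum>c\<in>Basis. (?Df x b \<bullet> c) *\<^sub>R partial_deriv T c g (f x))"
      using b by (auto simp: sum_inner_Basis_scaleR intro!: Ck_on_sum Ck_on_scaleR 1 2 assms(1))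
  qed
qed

section \<open>Linear systems with C^k coefficients and the inverse function theorem\<close>

text \<open>
  The map \<open>(y, w) \<mapsto> (y, A y w)\<close> is injective, so invariance of domain makes the solution continuous,
  and the inverse function theorem makes it differentiable. Differentiating the equation shows that
  each partial derivative of the solution solves an equation with the same \<open>A\<close>.
\<close>

lemma Ck_on_linear_solve:
  fixes A :: "'a::euclidean_space \<Rightarrow> 'c::euclidean_space \<Rightarrow> 'c"
  assumes S: "open S" and A: "\<And>u. u \<in> Basis \<Longrightarrow> Ck_on k S (\<lambda>y. A y u)"
    and lin: "\<And>y. y \<in> S \<Longrightarrow> linear (A y)" and inj: "\<And>y. y \<in> S \<Longrightarrow> inj (A y)"
    and "Ck_on k S b" and sol: "\<And>y. y \<in> S \<Longrightarrow> A y (v y) = b y"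
  shows "Ck_on k S v"
proof -
  \<comment> \<open>The basis expansion replaces \<open>A y w\<close> because smoothness is known
    only for the columns \<open>A y u\<close>. Over \<open>S\<close> the two agree by
    linearity.\<close>
  define \<Phi> where "\<Phi> = (\<lambda>(y, w). (y, \<Sum>u\<in>Basis. (w \<bullet> u) *\<^sub>R A y u))"
  have A_rep: "A y w = (\<Sum>u\<in>Basis. (w \<bullet> u) *\<^sub>R A y u)" if "y \<in> S" for y w
  proof -
    interpret linear "A y" using lin that .
    have "A y w = A y (\<Sum>u\<in>Basis. (w \<bullet> u) *\<^sub>R u)" by (simp add: euclidean_representation)
    then show ?thesis by (simp add: sum scaleR)
  qed
  have \<Phi>: "\<Phi> (y, w) = (y, A y w)" if "y \<in> S" for y w
    using A_rep[OF that, of w] by (simp add: \<Phi>_def)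
  have op: "open (S \<times> (UNIV :: 'c set))" using S by (simp add: open_Times)
  have sol': "solid S" "solid (S \<times> (UNIV :: 'c set))" using S op solid_open by auto
  have inj\<Phi>: "inj_on \<Phi> (S \<times> UNIV)"
  proof (rule inj_onI, clarify)
    fix y w y' w' assume "y \<in> S" "y' \<in> S" "\<Phi> (y, w) = \<Phi> (y', w')"
    then have "y = y'" "A y w = A y w'" by (auto simp: \<Phi>)
    then show "y = y' \<and> w = w'" using injD[OF inj[OF \<open>y \<in> S\<close>]] by blast
  qed
  define \<Psi> where "\<Psi> = inv_into (S \<times> UNIV) \<Phi>"
  have \<Psi>: "\<Psi> (\<Phi> p) = p" if "p \<in> S \<times> UNIV" for p
    using inj\<Phi> that by (simp add: \<Psi>_def)
  have v_eq: "w = snd (\<Psi> (y, c))" if "y \<in> S" "A y w = c" for y w c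
    using \<Psi>[of "(y, w)"] \<Phi>[OF that(1), of w] that by simp
  have Ck\<Phi>: "Ck_on j (S \<times> UNIV) \<Phi>" if A: "\<And>u. u \<in> Basis \<Longrightarrow> Ck_on j S (\<lambda>y. A y u)" for j
    unfolding \<Phi>_def case_prod_unfold
    by (intro Ck_on_Pair Ck_on_sum Ck_on_scaleR sol' Ck_on_linear bounded_linear_fst
        bounded_linear_compose[OF bounded_linear_inner_left bounded_linear_snd]
        Ck_on_compose[OF sol'(2,1) A]) auto
  have cont\<Phi>: "continuous_on (S \<times> UNIV) \<Phi>"
    by (rule Ck_on_continuous[of 0], rule Ck\<Phi>, rule Ck_on_mono[OF A]) auto
  have img: "(y, c) \<in> \<Phi> ` (S \<times> UNIV)" if "y \<in> S" for y c
  proof -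
    have "surj (A y)" using inj lin that linear_injective_imp_surjective by blast
    then obtain w where "A y w = c" by (metis surjD)
    then show ?thesis using \<Phi>[OF that, of w] that image_eqI[of "(y, c)" \<Phi> "(y, w)" "S \<times> UNIV"] by simp
  qed
  have cont\<Psi>: "continuous_on (\<Phi> ` (S \<times> UNIV)) \<Psi>"
    unfolding \<Psi>_def by (rule continuous_on_inverse_open[OF op cont\<Phi>]) (use inj\<Phi> in auto)
  show ?thesis
    using A assms(5) sol
  proof (induction k arbitrary: v b)
    case 0
    have "continuous_on S (\<lambda>y. snd (\<Psi> (y, b y)))"
      using 0 img by (intro continuous_intros continuous_on_compose2[OF cont\<Psi>]) auto
    then show ?case
      using v_eq[OF _ 0(3)] by (simp cong: continuous_on_cong)
  next
    case (Suc k)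
    let ?D = "\<lambda>y h. \<Sum>c\<in>Basis. (h \<bullet> c) *\<^sub>R partial_deriv S c b y"
    let ?DA = "\<lambda>y h w. \<Sum>u\<in>Basis. (w \<bullet> u) *\<^sub>R (\<Sum>c\<in>Basis. (h \<bullet> c) *\<^sub>R partial_deriv S c (\<lambda>z. A z u) y)"
    have "\<exists>D. (v has_derivative D) (at y) \<and> (\<forall>h. A y (D h) = ?D y h - ?DA y h (v y))" if y: "y \<in> S" for y
    proof -
      define \<Phi>' where "\<Phi>' = (\<lambda>(h, w). (h, A y w + ?DA y h (v y)))"
      have at: "at y within S = at y" by (rule at_within_open[OF y S])
      have dA: "((\<lambda>z. A z u) has_derivative (\<lambda>h. \<Sum>c\<in>Basis. (h \<bullet> c) *\<^sub>R partial_deriv S c (\<lambda>z. A z u) y)) (at y)"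
        if "u \<in> Basis" for u
        using Ck_on_Suc_has_derivative[OF Suc.prems(1)[OF that] y] unfolding at .
      have db: "(b has_derivative ?D y) (at y)"
        using Ck_on_Suc_has_derivative[OF Suc.prems(2) y] unfolding at .
      have dA': "((\<lambda>p. A (fst p) u) has_derivative (\<lambda>p. \<Sum>c\<in>Basis. (fst p \<bullet> c) *\<^sub>R partial_deriv S c (\<lambda>z. A z u) y)) (at (y, v y))"
        if "u \<in> Basis" for u
        using has_derivative_compose[OF has_derivative_fst[OF has_derivative_ident], of "\<lambda>z. A z u" _ "(y, v y)" UNIV,
            unfolded fst_conv, OF dA[OF that]] .
      have d\<Phi>: "(\<Phi> has_derivative \<Phi>') (at (y, v y))"
        unfolding \<Phi>_def \<Phi>'_def case_prod_unfold
      proof (rule has_derivative_eq_rhs[OF has_derivative_Pair[OF has_derivative_fst[OF has_derivative_ident]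
              has_derivative_sum[OF has_derivative_scaleR[OF
                  has_derivative_inner_left[OF has_derivative_snd[OF has_derivative_ident]] dA']]]])
        show "(\<lambda>p. (fst p, \<Sum>u\<in>Basis. (snd (y, v y) \<bullet> u) *\<^sub>R
                 (\<Sum>c\<in>Basis. (fst p \<bullet> c) *\<^sub>R partial_deriv S c (\<lambda>z. A z u) y) +
               (snd p \<bullet> u) *\<^sub>R A (fst (y, v y)) u)) =
            (\<lambda>p. (fst p, A y (snd p) + ?DA y (fst p) (v y)))"
        proof
          fix p :: "'a \<times> 'c"
          show "(fst p, \<Sum>u\<in>Basis. (snd (y, v y) \<bullet> u) *\<^sub>R
                 (\<Sum>c\<in>Basis. (fst p \<bullet> c) *\<^sub>R partial_deriv S c (\<lambda>z. A z u) y) +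
               (snd p \<bullet> u) *\<^sub>R A (fst (y, v y)) u) = (fst p, A y (snd p) + ?DA y (fst p) (v y))"
            unfolding A_rep[OF y, of "snd p"] fst_conv snd_conv sum.distrib by (simp only: add.commute)
        qed
      qed
      have lin': "linear \<Phi>'"
        using d\<Phi> has_derivative_linear by blast
      \<comment> \<open>The derivative is block triangular: \<open>h = 0\<close> is read off the
        first component, and then \<open>A y\<close> is injective.\<close>
      have "inj \<Phi>'"
        unfolding linear_injective_0[OF lin']
        using linear_injective_0[OF lin[OF y]] inj[OF y] by (auto simp: \<Phi>'_def zero_prod_def)
      then obtain g' where g': "linear g'" "\<Phi>' \<circ> g' = id"
        using linear_injective_imp_surjective[OF lin'] linear_surjective_right_inverse[OF lin'] by blast
      have g'_eq: "fst (g' (h, e)) = h" "A y (snd (g' (h, e))) = e - ?DA y h (v y)" for h e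
      proof -
        have "\<Phi>' (g' (h, e)) = (h, e)" using g'(2) by (metis comp_apply id_apply)
        then show "fst (g' (h, e)) = h" "A y (snd (g' (h, e))) = e - ?DA y h (v y)"
          unfolding \<Phi>'_def case_prod_unfold by (auto simp: algebra_simps)
      qed
      have "(\<Psi> has_derivative g') (at (\<Phi> (y, v y)))"
        by (rule has_derivative_inverse_strong[OF op _ cont\<Phi> \<Psi> d\<Phi> g'(2)]) (use y in auto)
      then have "(\<Psi> has_derivative g') (at (y, b y))"
        using \<Phi>[OF y] Suc.prems(3)[OF y] by simp
      from has_derivative_compose[OF has_derivative_Pair[OF has_derivative_ident db] this]
      have "((\<lambda>z. snd (\<Psi> (z, b z))) has_derivative (\<lambda>h. snd (g' (h, ?D y h)))) (at y)"
        by (rule has_derivative_snd)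
      then have "(v has_derivative (\<lambda>h. snd (g' (h, ?D y h)))) (at y)"
        by (rule has_derivative_transform_within_open[OF _ S y]) (simp add: v_eq[OF _ Suc.prems(3)])
      then show ?thesis using g'_eq(2) by blast
    qed
    then have "\<forall>y\<in>S. \<exists>D. (v has_derivative D) (at y) \<and> (\<forall>h. A y (D h) = ?D y h - ?DA y h (v y))"
      by (rule ballI)
    from bchoice[OF this] obtain D where D: "\<And>y. y \<in> S \<Longrightarrow> (v has_derivative D y) (at y)"
      and D_sol: "\<And>y h. y \<in> S \<Longrightarrow> A y (D y h) = ?D y h - ?DA y h (v y)"
      by blast
    \<comment> \<open>The differentiated equation contains \<open>v\<close> on its right-hand side.
      So the induction hypothesis is used twice: here for \<open>v\<close>, and below for its
      partial derivatives.\<close>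
    have vk: "Ck_on k S v"
      using Suc.IH[OF _ Ck_on_SucD[OF Suc.prems(2)] Suc.prems(3)] Ck_on_SucD[OF Suc.prems(1)] by blast
    show ?case
    proof (rule Ck_on_SucI[where D = D, OF sol'(1)])
      fix y assume "y \<in> S"
      then show "(v has_derivative D y) (at y within S)"
        using D has_derivative_at_withinI by blast
    next
      fix c :: 'a assume c: "c \<in> Basis"
      have "Ck_on k S (\<lambda>y. ?D y c - ?DA y c (v y))"
        using c Suc.prems(1,2)
        by (auto simp: sum_inner_Basis_scaleR intro!: Ck_on_diff Ck_on_sum Ck_on_scaleR sol'(1)
            Ck_on_bounded_linear[OF _ bounded_linear_inner_left vk])
      then show "Ck_on k S (\<lambda>y. D y c)"
        using Suc.IH[of "\<lambda>y. ?D y c - ?DA y c (v y)" "\<lambda>y. D y c"] D_sol Ck_on_SucD[OF Suc.prems(1)] by blast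
    qed
  qed
qed

text \<open>A bootstrap: the derivative of the inverse solves a linear system whose coefficients are
  the partial derivatives of \<open>G\<close> composed with the inverse itself. If the inverse is of
  class C^j with j at most k, so are the coefficients, hence by \<open>Ck_on_linear_solve\<close>
  the derivative, and the inverse is of class C^(j+1).\<close>

theorem Ck_on_inv_into:
  fixes G :: "'a::euclidean_space \<Rightarrow> 'a"
  assumes S: "open S" and G: "Ck_on (Suc k) S G" and inj: "inj_on G S"
    and dG: "\<And>p. p \<in> S \<Longrightarrow> (G has_derivative G' p) (at p)"
    and ker: "\<And>p h. p \<in> S \<Longrightarrow> G' p h = 0 \<Longrightarrow> h = 0"
  shows "open (G ` S)" "Ck_on (Suc k) (G ` S) (inv_into S G)"
proof -
  have contG: "continuous_on S G" using Ck_on_continuous[OF G] .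
  show op: "open (G ` S)" by (rule invariance_of_domain[OF contG S inj])
  let ?g = "inv_into S G"
  have gG: "?g (G p) = p" if "p \<in> S" for p using inj that by simp
  have cont: "continuous_on (G ` S) ?g" by (rule continuous_on_inverse_open[OF S contG]) (use inj in auto)
  have solid: "solid S" "solid (G ` S)" using S op solid_open by auto
  have lin: "linear (G' p)" if "p \<in> S" for p using dG[OF that] has_derivative_linear by blast
  have inj': "inj (G' p)" if "p \<in> S" for p using linear_injective_0[OF lin] ker that by blast
  have "\<exists>D. (?g has_derivative D) (at q) \<and> (\<forall>h. G' (?g q) (D h) = h)" if q: "q \<in> G ` S" for q
  proof -
    obtain p where p: "p \<in> S" "q = G p" using q by blast
    obtain g' where g': "linear g'" "G' p \<circ> g' = id"
      using linear_injective_imp_surjective[OF lin inj'] linear_surjective_right_inverse[OF lin] p(1) by blast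
    have "(?g has_derivative g') (at (G p))"
      by (rule has_derivative_inverse_strong[OF S p(1) contG gG dG[OF p(1)] g'(2)])
    then show ?thesis using g'(2) p gG by (metis comp_apply id_apply)
  qed
  then obtain D where D: "\<And>q. q \<in> G ` S \<Longrightarrow> (?g has_derivative D q) (at q)"
    and D_sol: "\<And>q h. q \<in> G ` S \<Longrightarrow> G' (?g q) (D q h) = h"
    by metis
  have "Ck_on j (G ` S) ?g" if "j \<le> Suc k" for j
    using that
  proof (induction j)
    case 0
    then show ?case using cont by simp
  next
    case (Suc j)
    show ?case
    proof (rule Ck_on_SucI[where D = D, OF solid(2)])
      fix q assume "q \<in> G ` S"
      then show "(?g has_derivative D q) (at q within G ` S)"
        using D has_derivative_at_withinI by blast
    next
      fix b :: 'a
      have g_in: "?g ` (G ` S) \<subseteq> S" using gG by auto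
      have "Ck_on j S (partial_deriv S u G)" if "u \<in> Basis" for u
        using Ck_on_mono[of k S "partial_deriv S u G" j] G Suc.prems that by auto
      then have "Ck_on j (G ` S) (\<lambda>q. partial_deriv S u G (?g q))" if "u \<in> Basis" for u
        using Ck_on_compose[OF solid(2,1) _ _ g_in, of j "partial_deriv S u G"] Suc that by auto
      moreover have "partial_deriv S u G (?g q) = G' (?g q) u" if "q \<in> G ` S" for q u
        using partial_deriv_eq[OF solid(1) _ has_derivative_at_withinI[OF dG]] g_in that by blast
      ultimately have "Ck_on j (G ` S) (\<lambda>q. G' (?g q) u)" if "u \<in> Basis" for u
        using Ck_on_cong[of "G ` S" "\<lambda>q. partial_deriv S u G (?g q)" "\<lambda>q. G' (?g q) u" j] that by simp
      then show "Ck_on j (G ` S) (\<lambda>q. D q b)"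
        using Ck_on_linear_solve[where A = "\<lambda>q. G' (?g q)" and v = "\<lambda>q. D q b" and b = "\<lambda>_. b"
            and S = "G ` S" and k = j] op lin inj' g_in D_sol Ck_on_const[OF solid(2), of j b] by blast
    qed
  qed
  then show "Ck_on (Suc k) (G ` S) ?g" by blast
qed

section \<open>Taylor expansion in partial derivatives\<close>

lemma finite_multi_dirs [simp]: "finite (multi_dirs k)"
  using finite_lists_length_eq[OF finite_Basis] by (simp add: multi_dirs_def)

lemma multi_dirs_0 [simp]: "multi_dirs 0 = {[]}"
  by (auto simp: multi_dirs_def)

lemma multi_dirs_Suc_Cons: "bij_betw (\<lambda>(b, bs). b # bs) ((Basis :: 'a::euclidean_space set) \<times> multi_dirs k) (multi_dirs (Suc k))"
  unfolding bij_betw_def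
proof
  have "cs \<in> (\<lambda>(b, bs). b # bs) ` (Basis \<times> multi_dirs k)" if mem: "cs \<in> multi_dirs (Suc k)" for cs :: "'a list"
  proof -
    obtain b bs where "cs = b # bs" "b \<in> Basis" "bs \<in> multi_dirs k"
      using mem by (cases cs) (auto simp: multi_dirs_def)
    then show ?thesis by auto
  qed
  moreover have "(\<lambda>(b, bs). b # bs) ` ((Basis :: 'a set) \<times> multi_dirs k) \<subseteq> multi_dirs (Suc k)"
    by (auto simp: multi_dirs_def)
  ultimately show "(\<lambda>(b, bs). b # bs) ` ((Basis :: 'a set) \<times> multi_dirs k) = multi_dirs (Suc k)" by blast
qed (auto simp: inj_on_def)

lemma multi_dirs_Suc_snoc: "bij_betw (\<lambda>(b, bs). bs @ [b]) ((Basis :: 'a::euclidean_space set) \<times> multi_dirs k) (multi_dirs (Suc k))"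
  unfolding bij_betw_def
proof
  have "cs \<in> (\<lambda>(b, bs). bs @ [b]) ` (Basis \<times> multi_dirs k)" if mem: "cs \<in> multi_dirs (Suc k)" for cs :: "'a list"
  proof -
    obtain b bs where "cs = bs @ [b]" "b \<in> Basis" "bs \<in> multi_dirs k"
      using mem by (cases cs rule: rev_cases) (auto simp: multi_dirs_def)
    then show ?thesis by auto
  qed
  moreover have "(\<lambda>(b, bs). bs @ [b]) ` ((Basis :: 'a set) \<times> multi_dirs k) \<subseteq> multi_dirs (Suc k)"
    by (auto simp: multi_dirs_def)
  ultimately show "(\<lambda>(b, bs). bs @ [b]) ` ((Basis :: 'a set) \<times> multi_dirs k) = multi_dirs (Suc k)" by blast
qed (auto simp: inj_on_def)

lemma sum_multi_dirs_Cons: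
  "sum F (multi_dirs (Suc k)) = (\<Sum>b\<in>Basis. \<Sum>bs\<in>multi_dirs k. F (b # bs))"
  using sum.reindex_bij_betw[OF multi_dirs_Suc_Cons, of F k]
  by (simp add: sum.cartesian_product case_prod_unfold)

lemma sum_multi_dirs_snoc:
  "sum F (multi_dirs (Suc k)) = (\<Sum>b\<in>Basis. \<Sum>bs\<in>multi_dirs k. F (bs @ [b]))"
  using sum.reindex_bij_betw[OF multi_dirs_Suc_snoc, of F k]
  by (simp add: sum.cartesian_product case_prod_unfold)

lemma iter_partial_snoc: "iter_partial S (bs @ [b]) f = iter_partial S bs (partial_deriv S b f)"
  by (induction bs) auto

lemma iter_partial_cong:
  assumes "\<And>x. x \<in> S \<Longrightarrow> f x = g x" "x \<in> S"
  shows "iter_partial S bs f x = iter_partial S bs g x"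
  using assms(2)
proof (induction bs arbitrary: x)
  case (Cons b bs)
  then show ?case using partial_deriv_cong[of S "iter_partial S bs f" "iter_partial S bs g" x b] by simp
qed (use assms(1) in simp)

lemma Ck_on_iter_partial:
  assumes "Ck_on k S f" "set bs \<subseteq> Basis" "length bs \<le> k"
  shows "Ck_on (k - length bs) S (iter_partial S bs f)"
  using assms(2,3)
proof (induction bs)
  case (Cons b bs)
  then have "k - length bs = Suc (k - length (b # bs))" by simp
  with Cons show ?case by simp
qed (use assms(1) in simp)

section \<open>Derivatives along lines and the symmetry of second derivatives\<close>

lemma has_derivative_line:
  assumes "open S" "f differentiable_on S" "w + s *\<^sub>R h \<in> S"
  shows "((\<lambda>s. f (w + s *\<^sub>R h)) has_vector_derivative
    (\<Sum>b\<in>Basis. (h \<bullet> b) *\<^sub>R partial_deriv S b f (w + s *\<^sub>R h))) (at s)"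
proof -
  have l: "((\<lambda>s. w + s *\<^sub>R h) has_derivative (\<lambda>t. t *\<^sub>R h)) (at s)"
    by (auto intro!: derivative_eq_intros)
  have "(f has_derivative (\<lambda>h'. \<Sum>b\<in>Basis. (h' \<bullet> b) *\<^sub>R partial_deriv S b f (w + s *\<^sub>R h))) (at (w + s *\<^sub>R h))"
    using has_derivative_partial[OF assms(2,3)] at_within_open[OF assms(3,1)] by simp
  from has_derivative_compose[OF l this] show ?thesis
    by (simp add: has_vector_derivative_def scaleR_sum_right)
qed

lemma has_real_derivative_line_Basis:
  fixes f :: "'a::euclidean_space \<Rightarrow> real"
  assumes "open S" "f differentiable_on S" "b \<in> Basis" "w + s *\<^sub>R b \<in> S"
  shows "((\<lambda>s. f (w + s *\<^sub>R b)) has_real_derivative partial_deriv S b f (w + s *\<^sub>R b)) (at s)"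
  using has_derivative_line[OF assms(1,2,4)]
    sum_inner_Basis_scaleR[OF assms(3), of "\<lambda>c. partial_deriv S c f (w + s *\<^sub>R b)"]
  by (simp add: has_real_derivative_iff_has_vector_derivative)

text \<open>The mean value theorem in direction \<open>u\<close>, applied to the difference of
  \<open>f\<close> on two parallel lines, is followed by the mean value theorem in direction
  \<open>v\<close> for the partial derivative. The left-hand side is symmetric in \<open>u\<close>
  and \<open>v\<close> while the right-hand side is not; symmetry of second derivatives comes from
  this.\<close>

lemma second_difference_mean_value:
  fixes f :: "'a::euclidean_space \<Rightarrow> real"
  assumes S: "open S" "ball x r \<subseteq> S" and f: "Ck_on (Suc (Suc k)) S f"
    and uv: "u \<in> Basis" "v \<in> Basis" and t: "0 < t" "2 * t < r"
  obtains y where "norm (y - x) \<le> 2 * t"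
    "f (x + t *\<^sub>R u + t *\<^sub>R v) - f (x + t *\<^sub>R u) - f (x + t *\<^sub>R v) + f x
       = t * t * partial_deriv S v (partial_deriv S u f) y"
proof -
  have n: "norm (s *\<^sub>R u + s' *\<^sub>R v) \<le> s + s'" if "0 \<le> s" "0 \<le> s'" for s s' :: real
    using norm_triangle_ineq[of "s *\<^sub>R u" "s' *\<^sub>R v"] that uv by simp
  have mem: "x + s *\<^sub>R u + s' *\<^sub>R v \<in> S" if "0 \<le> s" "s \<le> t" "0 \<le> s'" "s' \<le> t" for s s' :: real
  proof -
    have "dist (x + (s *\<^sub>R u + s' *\<^sub>R v)) x < r"
      using n[of s s'] that t unfolding dist_norm by simp
    then show ?thesis using S(2) by (auto simp: add.assoc dist_commute)
  qed
  have mem0: "x + s *\<^sub>R u \<in> S" if "0 \<le> s" "s \<le> t" for s using mem[of s 0] that t by simp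
  have d: "f differentiable_on S" "partial_deriv S u f differentiable_on S" using f uv by auto
  have "\<exists>\<sigma>>0. \<sigma> < t \<and> (f (x + t *\<^sub>R v + t *\<^sub>R u) - f (x + t *\<^sub>R u)) - (f (x + t *\<^sub>R v + 0 *\<^sub>R u) - f (x + 0 *\<^sub>R u))
      = (t - 0) * (partial_deriv S u f (x + t *\<^sub>R v + \<sigma> *\<^sub>R u) - partial_deriv S u f (x + \<sigma> *\<^sub>R u))"
    using mem mem0 t
    by (intro MVT2 DERIV_diff has_real_derivative_line_Basis[OF S(1) d(1) uv(1)])
      (auto simp: add.assoc add.commute add.left_commute)
  then obtain \<sigma> where \<sigma>: "0 < \<sigma>" "\<sigma> < t" "(f (x + t *\<^sub>R v + t *\<^sub>R u) - f (x + t *\<^sub>R u)) - (f (x + t *\<^sub>R v) - f x)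
      = t * (partial_deriv S u f (x + t *\<^sub>R v + \<sigma> *\<^sub>R u) - partial_deriv S u f (x + \<sigma> *\<^sub>R u))"
    by auto
  have "\<exists>\<tau>>0. \<tau> < t \<and> partial_deriv S u f (x + \<sigma> *\<^sub>R u + t *\<^sub>R v) - partial_deriv S u f (x + \<sigma> *\<^sub>R u + 0 *\<^sub>R v)
      = (t - 0) * partial_deriv S v (partial_deriv S u f) (x + \<sigma> *\<^sub>R u + \<tau> *\<^sub>R v)"
    using mem \<sigma> t by (intro MVT2 has_real_derivative_line_Basis[OF S(1) d(2) uv(2)]) auto
  then obtain \<tau> where \<tau>: "0 < \<tau>" "\<tau> < t"
    "partial_deriv S u f (x + \<sigma> *\<^sub>R u + t *\<^sub>R v) - partial_deriv S u f (x + \<sigma> *\<^sub>R u)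
      = t * partial_deriv S v (partial_deriv S u f) (x + \<sigma> *\<^sub>R u + \<tau> *\<^sub>R v)"
    by auto
  show ?thesis
  proof
    show "norm (x + \<sigma> *\<^sub>R u + \<tau> *\<^sub>R v - x) \<le> 2 * t" using n[of \<sigma> \<tau>] \<sigma> \<tau> by (simp add: add.assoc)
    show "f (x + t *\<^sub>R u + t *\<^sub>R v) - f (x + t *\<^sub>R u) - f (x + t *\<^sub>R v) + f x
       = t * t * partial_deriv S v (partial_deriv S u f) (x + \<sigma> *\<^sub>R u + \<tau> *\<^sub>R v)"
      using \<sigma>(3) \<tau>(3) by (simp add: algebra_simps)
  qed
qed

text \<open>Reading the same second difference in both orders makes the two mixed derivatives equal
  at two points arbitrarily close to \<open>x\<close>; continuity carries the equality to
  \<open>x\<close>.\<close>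

theorem partial_deriv_commute:
  fixes f :: "'a::euclidean_space \<Rightarrow> real"
  assumes S: "open S" and x: "x \<in> S" and f: "Ck_on (Suc (Suc k)) S f"
    and uv: "u \<in> Basis" "v \<in> Basis"
  shows "partial_deriv S u (partial_deriv S v f) x = partial_deriv S v (partial_deriv S u f) x"
proof (rule ccontr)
  let ?a = "partial_deriv S u (partial_deriv S v f)" and ?b = "partial_deriv S v (partial_deriv S u f)"
  assume neq: "?a x \<noteq> ?b x"
  define e where "e = \<bar>?a x - ?b x\<bar> / 2"
  have e: "e > 0" using neq by (simp add: e_def)
  have "continuous (at x) ?a" "continuous (at x) ?b"
    using f uv x Ck_on_continuous[of k S ?a] Ck_on_continuous[of k S ?b] continuous_on_eq_continuous_at[OF S]
    by auto
  then obtain r1 r2 where r: "r1 > 0" "r2 > 0"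
    and r1: "\<And>y. dist y x < r1 \<Longrightarrow> dist (?a y) (?a x) < e"
    and r2: "\<And>y. dist y x < r2 \<Longrightarrow> dist (?b y) (?b x) < e"
    unfolding continuous_at_eps_delta using e by metis
  obtain r where r0: "r > 0" "ball x r \<subseteq> S" using S x open_contains_ball by blast
  \<comment> \<open>The intermediate points lie within \<open>2 * t\<close> of \<open>x\<close>, and
    a third of the least radius keeps this strictly below all three radii.\<close>
  define t where "t = min r (min r1 r2) / 3"
  have t: "0 < t" "2 * t < r" "2 * t < r1" "2 * t < r2" using r r0 by (auto simp: t_def)
  obtain y where y: "norm (y - x) \<le> 2 * t"
    "f (x + t *\<^sub>R u + t *\<^sub>R v) - f (x + t *\<^sub>R u) - f (x + t *\<^sub>R v) + f x = t * t * ?b y"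
    using second_difference_mean_value[OF S r0(2) f uv t(1,2)] .
  obtain z where z: "norm (z - x) \<le> 2 * t"
    "f (x + t *\<^sub>R v + t *\<^sub>R u) - f (x + t *\<^sub>R v) - f (x + t *\<^sub>R u) + f x = t * t * ?a z"
    using second_difference_mean_value[OF S r0(2) f uv(2,1) t(1,2)] .
  have "x + t *\<^sub>R v + t *\<^sub>R u = x + t *\<^sub>R u + t *\<^sub>R v" by simp
  then have "t * t * ?a z = t * t * ?b y" using y(2) z(2) unfolding \<open>x + t *\<^sub>R v + t *\<^sub>R u = _\<close> by linarith
  then have "?a z = ?b y" using t by simp
  moreover have "dist (?a z) (?a x) < e" "dist (?b y) (?b x) < e"
    using r1[of z] r2[of y] y z t by (auto simp: dist_norm)
  moreover have "\<bar>?a x - ?b x\<bar> = 2 * e" by (simp add: e_def)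
  ultimately show False unfolding dist_real_def by argo
qed

section \<open>Taylor terms and remainders\<close>

text \<open>The k-th derivative at \<open>z\<close> as a multilinear form, evaluated on (x, ..., x).
  Base point and direction are separate arguments: the remainder formula moves \<open>z\<close>
  along a ray, while the gradient of the Taylor polynomial varies \<open>x\<close> with
  \<open>z\<close> fixed.\<close>

definition taylor_term :: "'a::euclidean_space set \<Rightarrow> nat \<Rightarrow> ('a \<Rightarrow> real) \<Rightarrow> 'a \<Rightarrow> 'a \<Rightarrow> real" where
  "taylor_term S k f z x = (\<Sum>bs\<in>multi_dirs k. iter_partial S bs f z * (\<Prod>b\<leftarrow>bs. x \<bullet> b))"

lemma taylor_term_0 [simp]: "taylor_term S 0 f z x = f z"
  by (simp add: taylor_term_def)

lemma taylor_term_Suc: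
  "taylor_term S (Suc k) f z x = (\<Sum>b\<in>Basis. (x \<bullet> b) * taylor_term S k (partial_deriv S b f) z x)"
  unfolding taylor_term_def sum_multi_dirs_snoc
  by (simp add: iter_partial_snoc sum_distrib_left mult_ac)

lemma taylor_term_cong:
  assumes "\<And>x. x \<in> S \<Longrightarrow> f x = g x" "z \<in> S"
  shows "taylor_term S k f z x = taylor_term S k g z x"
  unfolding taylor_term_def using iter_partial_cong[OF assms] by simp

text \<open>The product rule on the peeled-off factor gives one term, and the induction hypothesis
  gives k + 1 copies of a term whose new direction sits in another slot. Symmetry of second
  derivatives makes all of them equal, which accounts for the factor \<open>Suc k\<close>.\<close>

lemma taylor_term_has_derivative:
  assumes S: "open S" and z: "z \<in> S" and "Ck_on (Suc k) S f"
  shows "(taylor_term S (Suc k) f z has_derivative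
    (\<lambda>u. Suc k * (\<Sum>b\<in>Basis. (u \<bullet> b) * taylor_term S k (partial_deriv S b f) z x))) (at x)"
  using assms(3)
proof (induction k arbitrary: f)
  case 0
  show ?case unfolding taylor_term_Suc by (auto intro!: derivative_eq_intros)
next
  case (Suc k)
  let ?p = "partial_deriv S"
  have IH: "((\<lambda>x. taylor_term S (Suc k) (?p b f) z x) has_derivative
      (\<lambda>u. Suc k * (\<Sum>c\<in>Basis. (u \<bullet> c) * taylor_term S k (?p c (?p b f)) z x))) (at x)"
    if "b \<in> Basis" for b using Suc.IH[of "?p b f"] Suc.prems that by simp
  have comm: "taylor_term S k (?p c (?p b f)) z x = taylor_term S k (?p b (?p c f)) z x"
    if "b \<in> Basis" "c \<in> Basis" for b c
    using partial_deriv_commute[OF S _ Suc.prems that(2,1)] z by (intro taylor_term_cong) auto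
  have "(\<Sum>b\<in>Basis. (x \<bullet> b) * (Suc k * (\<Sum>c\<in>Basis. (u \<bullet> c) * taylor_term S k (?p c (?p b f)) z x))) =
     Suc k * (\<Sum>c\<in>Basis. (u \<bullet> c) * taylor_term S (Suc k) (?p c f) z x)" (is "?l = ?r") for u
  proof -
    have "?l = Suc k * (\<Sum>b\<in>Basis. \<Sum>c\<in>Basis. (u \<bullet> c) * ((x \<bullet> b) * taylor_term S k (?p b (?p c f)) z x))"
      by (simp add: comm sum_distrib_left mult_ac)
    also have "\<dots> = ?r"
      unfolding taylor_term_Suc sum_distrib_left by (subst sum.swap) simp
    finally show ?thesis .
  qed
  note sw = this
  have "((\<lambda>x. \<Sum>b\<in>Basis. (x \<bullet> b) * taylor_term S (Suc k) (?p b f) z x) has_derivative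
     (\<lambda>u. \<Sum>b\<in>Basis. (x \<bullet> b) * (Suc k * (\<Sum>c\<in>Basis. (u \<bullet> c) * taylor_term S k (?p c (?p b f)) z x))
        + (u \<bullet> b) * taylor_term S (Suc k) (?p b f) z x)) (at x)"
    by (intro has_derivative_sum has_derivative_mult IH has_derivative_inner_left has_derivative_ident)
  then show ?case
    unfolding taylor_term_Suc[of S "Suc k"] sum.distrib sw
    by (simp add: algebra_simps)
qed

definition taylor_sum :: "'a::euclidean_space set \<Rightarrow> nat \<Rightarrow> ('a \<Rightarrow> real) \<Rightarrow> 'a \<Rightarrow> real" where
  "taylor_sum S d f x = (\<Sum>k\<le>d. taylor_term S k f 0 x / fact k)"

text \<open>Since \<open>Suc k\<close> turns 1/(k+1)! into 1/k!, differentiating a Taylor polynomial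
  gives Taylor polynomials of the partial derivatives. The error of the gradient is thereby again a
  Taylor remainder.\<close>

lemma taylor_sum_has_derivative:
  assumes "open S" "0 \<in> S" "Ck_on (Suc d) S f"
  shows "(taylor_sum S (Suc d) f has_derivative
    (\<lambda>u. \<Sum>b\<in>Basis. (u \<bullet> b) * taylor_sum S d (partial_deriv S b f) x)) (at x)"
proof -
  have "((\<lambda>x. f 0 + (\<Sum>k\<le>d. taylor_term S (Suc k) f 0 x / fact (Suc k))) has_derivative
      (\<lambda>u. 0 + (\<Sum>k\<le>d. (Suc k * (\<Sum>b\<in>Basis. (u \<bullet> b) * taylor_term S k (partial_deriv S b f) 0 x)) / fact (Suc k)))) (at x)"
    by (intro has_derivative_add has_derivative_const has_derivative_sum 
        bounded_linear.has_derivative[OF bounded_linear_divide] taylor_term_has_derivative[OF assms(1,2)]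
        Ck_on_mono[OF assms(3)]) auto
  moreover have "f 0 + (\<Sum>k\<le>d. taylor_term S (Suc k) f 0 x / fact (Suc k)) = taylor_sum S (Suc d) f x" for x
    unfolding taylor_sum_def sum.atMost_Suc_shift by simp
  moreover have "0 + (\<Sum>k\<le>d. (Suc k * (\<Sum>b\<in>Basis. (u \<bullet> b) * taylor_term S k (partial_deriv S b f) 0 x)) / fact (Suc k))
     = (\<Sum>b\<in>Basis. (u \<bullet> b) * taylor_sum S d (partial_deriv S b f) x)" for u
  proof -
    have "(Suc k * c) / fact (Suc k) = c / (fact k :: real)" for k and c :: real
      by (simp add: fact_Suc del: of_nat_Suc)
    then show ?thesis
      unfolding taylor_sum_def sum_distrib_left sum_divide_distrib by (subst sum.swap) (simp add: sum_distrib_left sum_divide_distrib)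
  qed
  ultimately show ?thesis by simp
qed

text \<open>Moving the base point along \<open>x\<close> puts one more direction at the head of each
  list, so \<open>sum_multi_dirs_Cons\<close> reassembles the sum without any commutation of
  derivatives.\<close>

lemma taylor_term_line_derivative:
  assumes S: "open S" and f: "Ck_on (Suc d) S f" and m: "m < Suc d" and t: "t *\<^sub>R x \<in> S"
  shows "((\<lambda>t. taylor_term S m f (t *\<^sub>R x) x) has_real_derivative taylor_term S (Suc m) f (t *\<^sub>R x) x) (at t)"
proof -
  have "((\<lambda>t. iter_partial S bs f (t *\<^sub>R x)) has_real_derivative
      (\<Sum>b\<in>Basis. (x \<bullet> b) * iter_partial S (b # bs) f (t *\<^sub>R x))) (at t)"
    if bs: "bs \<in> multi_dirs m" for bs
  proof -
    have "Ck_on (Suc d - length bs) S (iter_partial S bs f)"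
      using Ck_on_iter_partial[OF f, of bs] bs m by (simp add: multi_dirs_def)
    moreover have "Suc d - length bs = Suc (d - length bs)"
      using bs m by (auto simp: multi_dirs_def)
    ultimately have "iter_partial S bs f differentiable_on S" by simp
    from has_derivative_line[OF S this, of 0 t x] t
    show ?thesis by (simp add: has_real_derivative_iff_has_vector_derivative)
  qed
  then have "((\<lambda>t. taylor_term S m f (t *\<^sub>R x) x) has_real_derivative
     (\<Sum>bs\<in>multi_dirs m. (\<Sum>b\<in>Basis. (x \<bullet> b) * iter_partial S (b # bs) f (t *\<^sub>R x)) * (\<Prod>b\<leftarrow>bs. x \<bullet> b))) (at t)"
    unfolding taylor_term_def by (intro DERIV_sum DERIV_cmult_right)
  also have "(\<Sum>bs\<in>multi_dirs m. (\<Sum>b\<in>Basis. (x \<bullet> b) * iter_partial S (b # bs) f (t *\<^sub>R x)) * (\<Prod>b\<leftarrow>bs. x \<bullet> b))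
      = taylor_term S (Suc m) f (t *\<^sub>R x) x"
    unfolding taylor_term_def sum_multi_dirs_Cons sum_distrib_right
    by (subst sum.swap) (simp add: mult_ac)
  finally show ?thesis .
qed

text \<open>For a linear combination of functions one intermediate point serves all remainder terms;
  for the gradient this avoids summing suprema taken at different points.\<close>

lemma taylor_sum_remainder:
  assumes S: "open S" and F: "\<And>i. i \<in> I \<Longrightarrow> Ck_on (Suc d) S (F i)"
    and ray: "\<And>t. 0 \<le> t \<Longrightarrow> t \<le> 1 \<Longrightarrow> t *\<^sub>R x \<in> S"
  obtains t where "0 < t" "t < 1"
    "(\<Sum>i\<in>I. w i * (F i x - taylor_sum S d (F i) x))
       = (\<Sum>i\<in>I. w i * taylor_term S (Suc d) (F i) (t *\<^sub>R x) x) / fact (Suc d)"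
proof -
  have "\<exists>t>0. t < 1 \<and> (\<lambda>t. \<Sum>i\<in>I. w i * F i (t *\<^sub>R x)) 1
      = (\<Sum>m<Suc d. (\<Sum>i\<in>I. w i * taylor_term S m (F i) (0 *\<^sub>R x) x) / fact m * 1 ^ m)
        + (\<Sum>i\<in>I. w i * taylor_term S (Suc d) (F i) (t *\<^sub>R x) x) / fact (Suc d) * 1 ^ Suc d"
    by (intro Maclaurin allI impI DERIV_sum DERIV_cmult taylor_term_line_derivative[OF S F])
      (use ray in auto)
  then obtain t where t: "t > 0" "t < 1" "(\<Sum>i\<in>I. w i * F i x)
      = (\<Sum>m<Suc d. (\<Sum>i\<in>I. w i * taylor_term S m (F i) 0 x) / fact m)
        + (\<Sum>i\<in>I. w i * taylor_term S (Suc d) (F i) (t *\<^sub>R x) x) / fact (Suc d)"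
    by auto
  have "(\<Sum>m<Suc d. (\<Sum>i\<in>I. w i * taylor_term S m (F i) 0 x) / fact m) = (\<Sum>i\<in>I. w i * taylor_sum S d (F i) x)"
    unfolding taylor_sum_def sum_distrib_left sum_divide_distrib lessThan_Suc_atMost
    by (subst sum.swap) simp
  with t show ?thesis
    using that[of t] by (simp add: right_diff_distrib sum_subtractf)
qed

text \<open>In the unit ball every product of coordinates is at most 1 in absolute value. This is
  what makes the sum over all tuples, as in \<open>M\<close>, the matching norm for the
  remainder.\<close>

lemma abs_taylor_term_le:
  assumes "norm x \<le> 1"
  shows "\<bar>taylor_term S k f z x\<bar> \<le> (\<Sum>bs\<in>multi_dirs k. \<bar>iter_partial S bs f z\<bar>)"
proof -
  have "\<bar>\<Prod>b\<leftarrow>bs. x \<bullet> b\<bar> \<le> 1" if "set bs \<subseteq> Basis" for bs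
    using that
  proof (induction bs)
    case (Cons b bs)
    then have "\<bar>x \<bullet> b\<bar> \<le> 1" using Basis_le_norm[of b x] assms by simp
    then show ?case using Cons mult_mono[of "\<bar>x \<bullet> b\<bar>" 1 "\<bar>\<Prod>b\<leftarrow>bs. x \<bullet> b\<bar>" 1] by (simp add: abs_mult)
  qed simp
  then have "\<bar>iter_partial S bs f z * (\<Prod>b\<leftarrow>bs. x \<bullet> b)\<bar> \<le> \<bar>iter_partial S bs f z\<bar>" if "bs \<in> multi_dirs k" for bs
    using that mult_left_mono[of "\<bar>\<Prod>b\<leftarrow>bs. x \<bullet> b\<bar>" 1 "\<bar>iter_partial S bs f z\<bar>"] by (simp add: abs_mult multi_dirs_def)
  then show ?thesis
    unfolding taylor_term_def by (intro order_trans[OF sum_abs sum_mono])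
qed

section \<open>Polynomials and the constants\<close>

lemma finite_multi_indices: "finite {\<alpha> :: 'n::finite \<Rightarrow> nat. (\<Sum>i\<in>UNIV. \<alpha> i) \<le> d}"
proof (rule finite_subset)
  show "{\<alpha> :: 'n \<Rightarrow> nat. (\<Sum>i\<in>UNIV. \<alpha> i) \<le> d} \<subseteq> PiE UNIV (\<lambda>_. {..d})"
  proof
    fix \<alpha> :: "'n \<Rightarrow> nat" assume a: "\<alpha> \<in> {\<alpha>. (\<Sum>i\<in>UNIV. \<alpha> i) \<le> d}"
    have "\<alpha> i \<le> d" for i using a member_le_sum[of i UNIV \<alpha>] by (auto intro: order_trans)
    then show "\<alpha> \<in> PiE UNIV (\<lambda>_. {..d})" by auto
  qed
qed (rule finite_PiE; simp)

lemma poly_deg_le_0: "poly_deg_le d (\<lambda>x. 0)"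
  unfolding poly_deg_le_def by (rule exI[of _ "\<lambda>_. 0"]) simp

lemma poly_deg_le_add:
  assumes "poly_deg_le d P" "poly_deg_le d Q"
  shows "poly_deg_le d (\<lambda>x. P x + Q x)"
proof -
  obtain a b where "P = (\<lambda>x. \<Sum>\<alpha> | (\<Sum>i\<in>UNIV. \<alpha> i) \<le> d. a \<alpha> * (\<Prod>i\<in>UNIV. (x $ i) ^ \<alpha> i))"
    "Q = (\<lambda>x. \<Sum>\<alpha> | (\<Sum>i\<in>UNIV. \<alpha> i) \<le> d. b \<alpha> * (\<Prod>i\<in>UNIV. (x $ i) ^ \<alpha> i))"
    using assms unfolding poly_deg_le_def by blast
  then show ?thesis
    unfolding poly_deg_le_def by (intro exI[of _ "\<lambda>\<alpha>. a \<alpha> + b \<alpha>"]) (simp add: sum.distrib distrib_right)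
qed

lemma poly_deg_le_sum:
  assumes "\<And>i. i \<in> I \<Longrightarrow> poly_deg_le d (P i)"
  shows "poly_deg_le d (\<lambda>x. \<Sum>i\<in>I. P i x)"
  using assms by (induction I rule: infinite_finite_induct) (auto intro: poly_deg_le_0 poly_deg_le_add)

text \<open>The exponent \<alpha> i counts how often the i-th axis occurs in
  \<open>bs\<close>.\<close>

lemma prod_list_inner_Basis:
  assumes "set bs \<subseteq> (Basis :: (real ^ 'n::finite) set)"
  shows "\<exists>\<alpha> :: 'n \<Rightarrow> nat. (\<Sum>i\<in>UNIV. \<alpha> i) = length bs \<and> (\<forall>x. (\<Prod>b\<leftarrow>bs. x \<bullet> b) = (\<Prod>i\<in>UNIV. (x $ i) ^ \<alpha> i))"
  using assms
proof (induction bs)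
  case Nil
  show ?case by (rule exI[of _ "\<lambda>_. 0"]) simp
next
  case (Cons b bs)
  then obtain \<alpha> :: "'n \<Rightarrow> nat" where \<alpha>: "(\<Sum>i\<in>UNIV. \<alpha> i) = length bs"
    "\<And>x. (\<Prod>b\<leftarrow>bs. x \<bullet> b) = (\<Prod>i\<in>UNIV. (x $ i) ^ \<alpha> i)" by auto
  obtain j where j: "b = axis j 1" using Cons.prems by (auto simp: Basis_vec_def)
  define \<beta> where "\<beta> i = \<alpha> i + (if i = j then 1 else 0)" for i
  have "(\<Sum>i\<in>UNIV. \<beta> i) = length (b # bs)" by (simp add: \<beta>_def sum.distrib \<alpha>)
  moreover have "(\<Prod>b\<leftarrow>b # bs. x \<bullet> b) = (\<Prod>i\<in>UNIV. (x $ i) ^ \<beta> i)" for x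
  proof -
    have "(x $ i) ^ (if i = j then 1 else 0) = (if i = j then x $ j else 1)" for i by simp
    then show ?thesis
      by (simp add: \<beta>_def power_add prod.distrib \<alpha>(2) j inner_axis' inner_axis)
  qed
  ultimately show ?case by blast
qed

lemma poly_deg_le_prod_list:
  assumes "set bs \<subseteq> (Basis :: (real ^ 'n::finite) set)" "length bs \<le> d"
  shows "poly_deg_le d (\<lambda>x. c * (\<Prod>b\<leftarrow>bs. x \<bullet> b))"
proof -
  obtain \<alpha> :: "'n \<Rightarrow> nat" where \<alpha>: "(\<Sum>i\<in>UNIV. \<alpha> i) = length bs"
    "\<And>x. (\<Prod>b\<leftarrow>bs. x \<bullet> b) = (\<Prod>i\<in>UNIV. (x $ i) ^ \<alpha> i)" using prod_list_inner_Basis[OF assms(1)] by auto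
  have "(\<Sum>\<beta> | (\<Sum>i\<in>UNIV. \<beta> i) \<le> d. (if \<beta> = \<alpha> then c else 0) * (\<Prod>i\<in>UNIV. (x $ i) ^ \<beta> i))
      = (\<Sum>\<beta> | (\<Sum>i\<in>UNIV. \<beta> i) \<le> d. if \<beta> = \<alpha> then c * (\<Prod>i\<in>UNIV. (x $ i) ^ \<alpha> i) else 0)" for x
    by (rule sum.cong) auto
  then show ?thesis
    unfolding poly_deg_le_def using \<alpha> assms(2) finite_multi_indices[where 'n='n and d=d]
    by (intro exI[of _ "\<lambda>\<beta>. if \<beta> = \<alpha> then c else 0"]) simp
qed

lemma poly_deg_le_taylor_poly: "poly_deg_le d (taylor_poly d f)"
proof -
  have "taylor_poly d f = (\<lambda>x. \<Sum>k\<le>d. \<Sum>bs\<in>multi_dirs k.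
      iter_partial (cball 0 1) bs f 0 / fact k * (\<Prod>b\<leftarrow>bs. x \<bullet> b))"
    unfolding taylor_poly_def by (simp add: sum_divide_distrib)
  moreover have "poly_deg_le d \<dots>"
    by (intro poly_deg_le_sum poly_deg_le_prod_list) (auto simp: multi_dirs_def)
  ultimately show ?thesis by simp
qed

lemma Ck_on_taylor_poly:
  assumes "solid S" shows "Ck_on k S (taylor_poly d f)"
proof -
  have "Ck_on k S (\<lambda>x. \<Prod>b\<leftarrow>bs. x \<bullet> b)" for bs
  proof (induction bs)
    case (Cons b bs)
    then show ?case
      using Ck_on_mult[OF assms Ck_on_linear[OF assms bounded_linear_inner_left]] by simp
  qed (simp add: Ck_on_const assms)
  moreover have "taylor_poly d f = (\<lambda>x. \<Sum>k\<le>d. \<Sum>bs\<in>multi_dirs k.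
      iter_partial (cball 0 1) bs f 0 / fact k * (\<Prod>b\<leftarrow>bs. x \<bullet> b))"
    unfolding taylor_poly_def by (simp add: sum_divide_distrib)
  ultimately show ?thesis
    by (simp only:) (intro Ck_on_sum Ck_on_mult assms Ck_on_const)
qed

lemma sum_abs_iter_partial_le_M:
  assumes "Ck_on l (cball 0 1) f" "z \<in> cball 0 1"
  shows "(\<Sum>bs\<in>multi_dirs l. \<bar>iter_partial (cball 0 1) bs f z\<bar>) \<le> M l f"
proof -
  have "continuous_on (cball 0 1) (iter_partial (cball 0 1) bs f)" if "bs \<in> multi_dirs l" for bs
    using Ck_on_continuous[OF Ck_on_iter_partial[OF assms(1), of bs]] that by (auto simp: multi_dirs_def)
  then have "continuous_on (cball 0 1) (\<lambda>z. \<Sum>bs\<in>multi_dirs l. \<bar>iter_partial (cball 0 1) bs f z\<bar>)"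
    by (intro continuous_intros) auto
  then have "compact ((\<lambda>z. \<Sum>bs\<in>multi_dirs l. \<bar>iter_partial (cball 0 1) bs f z\<bar>) ` cball 0 1)"
    by (rule compact_continuous_image) simp
  then show ?thesis
    unfolding M_def by (intro cSUP_upper assms bounded_imp_bdd_above compact_imp_bounded)
qed

text \<open>A coordinate function is bounded by 1 on the ball and its first derivative has norm 1,
  which leaves no smaller admissible constant. Together with the summand 1 in \<open>C2\<close> this
  gives C3 at least 2.\<close>

lemma poly_deriv_bound_ge_1:
  assumes "poly_deriv_bound TYPE('n::finite) d C" "d \<ge> 1"
  shows "C \<ge> 1"
proof -
  obtain b :: "real ^ 'n" where b: "b \<in> Basis" using nonempty_Basis by blast
  define P where "P x = x \<bullet> b" for x :: "real ^ 'n"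
  have poly: "poly_deg_le d P"
    using poly_deg_le_prod_list[of "[b]" d 1] b assms(2) by (simp add: P_def[abs_def])
  have s: "solid (cball (0 :: real ^ 'n) 1)" by (simp add: solid_cball)
  have Ck: "Ck_on k (cball 0 1) P" for k
    unfolding P_def by (rule Ck_on_linear[OF s bounded_linear_inner_left])
  have "partial_deriv (cball 0 1) c P z = c \<bullet> b" if "z \<in> cball 0 1" for c z
    by (rule partial_deriv_eq[OF s that]) (auto simp: P_def intro!: derivative_eq_intros)
  then have "(\<Sum>bs\<in>multi_dirs (Suc 0). \<bar>iter_partial (cball 0 1) bs P 0\<bar>) = (\<Sum>c\<in>Basis. \<bar>c \<bullet> b\<bar>)"
    unfolding sum_multi_dirs_Cons by simp
  also have "\<dots> = (\<Sum>c\<in>Basis. if c = b then 1 else 0)"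
    by (rule sum.cong) (use b in \<open>auto simp: inner_Basis\<close>)
  finally have "1 \<le> M (Suc 0) P" using sum_abs_iter_partial_le_M[OF Ck, of 0 "Suc 0"] b by simp
  also have "\<dots> \<le> C * M 0 P" using assms poly unfolding poly_deriv_bound_def by auto
  finally have 1: "1 \<le> C * M 0 P" .
  have "0 \<le> M 0 P" using sum_abs_iter_partial_le_M[OF Ck, of 0 0] by (simp add: P_def)
  moreover have "M 0 P \<le> 1"
    unfolding M_def
  proof (rule cSUP_least)
    fix z :: "real ^ 'n" assume "z \<in> cball 0 1"
    then show "(\<Sum>bs\<in>multi_dirs 0. \<bar>iter_partial (cball 0 1) bs P z\<bar>) \<le> 1"
      using Basis_le_norm[OF b, of z] by (simp add: P_def)
  qed simp
  ultimately have "C * M 0 P \<le> C" if "C \<ge> 0" using that mult_left_mono[of "M 0 P" 1 C] by simp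
  moreover have "C \<ge> 0"
  proof (rule ccontr)
    assume "\<not> C \<ge> 0"
    then have "C * M 0 P \<le> 0" using \<open>0 \<le> M 0 P\<close> by (simp add: mult_le_0_iff)
    with 1 show False by simp
  qed
  ultimately show ?thesis using 1 by linarith
qed

text \<open>The Taylor polynomial is defined by derivatives relative to the closed ball, while the
  expansion above lives on open sets. At the origin, an interior point, the two agree.\<close>

lemma taylor_poly_eq_taylor_sum:
  assumes "Ck_on (Suc d) (cball 0 1) f"
  shows "taylor_poly d f = taylor_sum (ball 0 1) d f"
proof
  fix x
  have "iter_partial (ball 0 1) bs f 0 = iter_partial (cball 0 1) bs f 0"
    if "k \<le> d" "bs \<in> multi_dirs k" for k and bs :: "'a list"
    using that assms
    by (intro iter_partial_subset(1)[of "ball 0 1" "cball 0 1" "Suc d"]) (auto simp: solid_open multi_dirs_def)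
  then show "taylor_poly d f x = taylor_sum (ball 0 1) d f x"
    unfolding taylor_poly_def taylor_sum_def taylor_term_def by (auto intro!: sum.cong)
qed

section \<open>Remainder estimates for the values and the gradient\<close>

context
  fixes f :: "'a::euclidean_space \<Rightarrow> real" and d :: nat
  assumes f: "Ck_on (Suc d) (cball 0 1) f"
begin

lemma Ck_on_unit_ball: "Ck_on (Suc d) (ball 0 1) f"
  by (rule Ck_on_subset[OF _ _ f]) (auto simp: solid_open)

lemma sum_abs_iter_partial_ball_le_M:
  assumes "z \<in> ball 0 1"
  shows "(\<Sum>bs\<in>multi_dirs (Suc d). \<bar>iter_partial (ball 0 1) bs f z\<bar>) \<le> M (Suc d) f"
proof -
  have "iter_partial (ball 0 1) bs f z = iter_partial (cball 0 1) bs f z" if "bs \<in> multi_dirs (Suc d)" for bs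
    using that assms f
    by (intro iter_partial_subset(1)[of "ball 0 1" "cball 0 1" "Suc d"]) (auto simp: solid_open multi_dirs_def)
  then have "(\<Sum>bs\<in>multi_dirs (Suc d). \<bar>iter_partial (ball 0 1) bs f z\<bar>)
      = (\<Sum>bs\<in>multi_dirs (Suc d). \<bar>iter_partial (cball 0 1) bs f z\<bar>)" by simp
  also have "\<dots> \<le> M (Suc d) f" using sum_abs_iter_partial_le_M[OF f, of z] assms by simp
  finally show ?thesis .
qed

lemma ray_in_ball:
  assumes "x \<in> ball 0 1" "0 \<le> t" "t \<le> 1" shows "t *\<^sub>R x \<in> ball (0::'a) 1"
  using assms mult_right_mono[of t 1 "norm x"] by simp

lemma abs_diff_taylor_poly_le:
  assumes x: "x \<in> ball 0 1"
  shows "\<bar>f x - taylor_poly d f x\<bar> \<le> M (Suc d) f / fact (Suc d)"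
proof -
  obtain t where t: "0 < t" "t < 1"
    "(\<Sum>i\<in>{()}. 1 * (f x - taylor_sum (ball 0 1) d f x))
       = (\<Sum>i\<in>{()}. 1 * taylor_term (ball 0 1) (Suc d) f (t *\<^sub>R x) x) / fact (Suc d)"
    using taylor_sum_remainder[of "ball 0 1" "{()}" d "\<lambda>_. f" x "\<lambda>_. 1"] Ck_on_unit_ball ray_in_ball[OF x]
    by auto
  have "\<bar>taylor_term (ball 0 1) (Suc d) f (t *\<^sub>R x) x\<bar> \<le> M (Suc d) f"
    using abs_taylor_term_le[of x "ball 0 1" "Suc d" f "t *\<^sub>R x"] x t
      sum_abs_iter_partial_ball_le_M[OF ray_in_ball[OF x, of t]] by simp
  then show ?thesis
    using t(3) by (simp add: taylor_poly_eq_taylor_sum[OF f] divide_right_mono del: fact_Suc)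
qed

text \<open>Pairing the error \<open>v\<close> with itself writes its squared norm as a combination
  of the remainders of all partial derivatives with weights \<open>v \<bullet> b\<close>. Evaluated
  at one common point, these add up to a single sum over \<open>multi_dirs (Suc d)\<close>, so no
  factor depending on the dimension appears.\<close>

lemma norm_gradient_diff_taylor_poly_le:
  assumes x: "x \<in> ball 0 1" and d: "d = Suc e"
  shows "norm (grad_on (ball 0 1) f x - grad_on UNIV (taylor_poly d f) x) \<le> M (Suc d) f / fact d"
proof -
  let ?p = "partial_deriv (ball 0 1)"
  define v where "v = grad_on (ball 0 1) f x - grad_on UNIV (taylor_poly d f) x"
  have B: "open (ball (0::'a) 1)" "0 \<in> ball (0::'a) 1" by auto
  have Ck: "Ck_on (Suc e) (ball 0 1) (?p b f)" if "b \<in> Basis" for b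
    using Ck_on_unit_ball that unfolding d by simp
  have dP: "partial_deriv UNIV b (taylor_poly d f) x = taylor_sum (ball 0 1) e (?p b f) x" if b: "b \<in> Basis" for b
  proof -
    have "(taylor_sum (ball 0 1) (Suc e) f has_derivative
        (\<lambda>u. \<Sum>b\<in>Basis. (u \<bullet> b) * taylor_sum (ball 0 1) e (?p b f) x)) (at x within UNIV)"
      using taylor_sum_has_derivative[OF B, of e f x] Ck_on_mono[OF Ck_on_unit_ball, of "Suc e"] d by simp
    from partial_deriv_eq[OF solid_open[OF open_UNIV] UNIV_I this, of b]
    show ?thesis
      using sum_inner_Basis_scaleR[OF b, of "\<lambda>b. taylor_sum (ball 0 1) e (?p b f) x"]
      unfolding taylor_poly_eq_taylor_sum[OF f] unfolding d by simp
  qed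
  have v: "v \<bullet> b = ?p b f x - taylor_sum (ball 0 1) e (?p b f) x" if "b \<in> Basis" for b
    using dP that by (simp add: v_def grad_on_def inner_diff_left inner_sum_left_Basis)
  have "norm v * norm v = (\<Sum>b\<in>Basis. (v \<bullet> b) * (?p b f x - taylor_sum (ball 0 1) e (?p b f) x))"
    using euclidean_inner[of v v] v
    by (simp add: power2_norm_eq_inner[symmetric] power2_eq_square cong: sum.cong)
  also obtain t where t: "0 < t" "t < 1"
    "(\<Sum>b\<in>Basis. (v \<bullet> b) * (?p b f x - taylor_sum (ball 0 1) e (?p b f) x))
       = (\<Sum>b\<in>Basis. (v \<bullet> b) * taylor_term (ball 0 1) (Suc e) (?p b f) (t *\<^sub>R x) x) / fact (Suc e)"
    using taylor_sum_remainder[of "ball 0 1" Basis e "\<lambda>b. ?p b f" x "\<lambda>b. v \<bullet> b"] Ck ray_in_ball[OF x] by auto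
  note t(3)
  also have "(\<Sum>b\<in>Basis. (v \<bullet> b) * taylor_term (ball 0 1) (Suc e) (?p b f) (t *\<^sub>R x) x)
      \<le> (\<Sum>b\<in>Basis. norm v * (\<Sum>bs\<in>multi_dirs (Suc e). \<bar>iter_partial (ball 0 1) bs (?p b f) (t *\<^sub>R x)\<bar>))"
  proof (rule sum_mono)
    fix b :: 'a assume b: "b \<in> Basis"
    have "(v \<bullet> b) * taylor_term (ball 0 1) (Suc e) (?p b f) (t *\<^sub>R x) x
      \<le> \<bar>v \<bullet> b\<bar> * \<bar>taylor_term (ball 0 1) (Suc e) (?p b f) (t *\<^sub>R x) x\<bar>"
      by (metis abs_ge_self abs_mult)
    also have "\<dots> \<le> norm v * (\<Sum>bs\<in>multi_dirs (Suc e). \<bar>iter_partial (ball 0 1) bs (?p b f) (t *\<^sub>R x)\<bar>)"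
      using x by (intro mult_mono Basis_le_norm[OF b] abs_taylor_term_le) auto
    finally show "(v \<bullet> b) * taylor_term (ball 0 1) (Suc e) (?p b f) (t *\<^sub>R x) x
      \<le> norm v * (\<Sum>bs\<in>multi_dirs (Suc e). \<bar>iter_partial (ball 0 1) bs (?p b f) (t *\<^sub>R x)\<bar>)" .
  qed
  also have "\<dots> = norm v * (\<Sum>bs\<in>multi_dirs (Suc d). \<bar>iter_partial (ball 0 1) bs f (t *\<^sub>R x)\<bar>)"
    unfolding d sum_multi_dirs_snoc[of _ "Suc e"] by (simp add: iter_partial_snoc sum_distrib_left)
  also have "\<dots> \<le> norm v * M (Suc d) f"
    using t ray_in_ball[OF x, of t] by (intro mult_left_mono sum_abs_iter_partial_ball_le_M) auto
  finally have *: "norm v * norm v \<le> norm v * (M (Suc d) f / fact d)"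
    by (simp add: d divide_right_mono del: fact_Suc)
  have "0 \<le> M (Suc d) f"
    using sum_abs_iter_partial_ball_le_M[of 0] by (auto intro: order_trans[OF sum_nonneg])
  with * show ?thesis
    unfolding v_def[symmetric] using mult_left_le_imp_le[OF *] by (cases "v = 0") auto
qed

end

text \<open>On the ball \<bar>f\<bar> is at most 1 and the remainder at most 1/(d+1)!, so the
  admissible constant bounds the Hessian by C (1 + 1/(d+1)!), which is C3 - 1. The bound
  \<open>M (Suc d) f \<le> 1\<close> is where the 1 in the definition of T enters. The constant
  covers only orders up to d, so d = 1 is separate: there P is affine and its Hessian
  vanishes.\<close>

lemma taylor_poly_hessian_bound:
  fixes f :: "real ^ 'n::finite \<Rightarrow> real"
  assumes f: "Ck_on (Suc d) (cball 0 1) f" and C: "poly_deriv_bound TYPE('n) d C" and d: "d \<ge> 1"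
    and "M 0 f = 1" "M (Suc d) f \<le> 1" and z: "z \<in> cball 0 1"
  shows "(\<Sum>bs\<in>multi_dirs (Suc (Suc 0)). \<bar>iter_partial UNIV bs (taylor_poly d f) z\<bar>) \<le> C3 d C"
proof -
  let ?P = "taylor_poly d f"
  have C1: "C \<ge> 1" using poly_deriv_bound_ge_1[OF C d] .
  have C3: "C3 d C = C * (1 + 1 / fact (Suc d)) + 1"
    by (simp add: C3_def C1_def C2_def algebra_simps)
  have UNIV: "solid (UNIV :: (real ^ 'n) set)" by (simp add: solid_open)
  have D: "solid (cball 0 1 :: (real ^ 'n) set)" by (simp add: solid_cball)
  have eq: "iter_partial (cball 0 1) bs ?P z = iter_partial UNIV bs ?P z" if "bs \<in> multi_dirs k" for bs k
    using that z by (intro iter_partial_subset(1)[of "cball 0 1" UNIV k] Ck_on_taylor_poly UNIV D)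
      (auto simp: multi_dirs_def)
  show ?thesis
  proof (cases "d = 1")
    case True
    have B: "open (ball (0 :: real ^ 'n) 1)" "0 \<in> ball (0 :: real ^ 'n) 1" by auto
    have "partial_deriv UNIV b ?P x = partial_deriv (ball 0 1) b f 0" if b: "b \<in> Basis" for b x
    proof -
      have "(taylor_sum (ball 0 1) (Suc 0) f has_derivative
          (\<lambda>u. \<Sum>b\<in>Basis. (u \<bullet> b) * partial_deriv (ball 0 1) b f 0)) (at x within UNIV)"
        using taylor_sum_has_derivative[OF B, of 0 f x] Ck_on_mono[OF Ck_on_unit_ball[OF f], of "Suc 0"]
        by (simp add: taylor_sum_def[of _ 0])
      from partial_deriv_eq[OF UNIV UNIV_I this, of b]
      show ?thesis
        using sum_inner_Basis_scaleR[OF b, of "\<lambda>b. partial_deriv (ball 0 1) b f 0"]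
        unfolding taylor_poly_eq_taylor_sum[OF f] unfolding True by simp
    qed
    then have "partial_deriv UNIV c (partial_deriv UNIV b ?P) z = partial_deriv UNIV c (\<lambda>_. partial_deriv (ball 0 1) b f 0) z"
      if "b \<in> Basis" for b c using that by (intro partial_deriv_cong) auto
    moreover have "partial_deriv UNIV c (\<lambda>_. a :: real) z = 0" for a c
      using partial_deriv_eq[OF UNIV UNIV_I has_derivative_const] .
    ultimately have "(\<Sum>bs\<in>multi_dirs (Suc (Suc 0)). \<bar>iter_partial UNIV bs ?P z\<bar>) = 0"
      unfolding sum_multi_dirs_Cons by simp
    then show ?thesis using C1 by (simp add: C3 add_nonneg_nonneg)
  next
    case False
    have "M 0 ?P \<le> 1 + 1 / fact (Suc d)"
      unfolding M_def
    proof (rule cSUP_least)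
      fix x :: "real ^ 'n" assume "x \<in> cball 0 1"
      then have x: "x \<in> closure (ball 0 1)" by simp
      \<comment> \<open>The remainder estimate is available on the open ball only; continuity of P
        extends it to the boundary.\<close>
      have "closed {x. \<bar>?P x\<bar> \<le> 1 + 1 / fact (Suc d)}"
        using Ck_on_continuous[OF Ck_on_taylor_poly[OF UNIV, of 0]]
        by (intro closed_Collect_le continuous_intros) auto
      moreover have "ball 0 1 \<subseteq> {x. \<bar>?P x\<bar> \<le> 1 + 1 / fact (Suc d)}"
      proof
        fix y :: "real ^ 'n" assume y: "y \<in> ball 0 1"
        have "\<bar>f y\<bar> \<le> 1"
          using sum_abs_iter_partial_le_M[of 0 f y] Ck_on_mono[OF f, of 0] y assms(4) by simp
        moreover have "\<bar>f y - ?P y\<bar> \<le> 1 / fact (Suc d)"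
          using abs_diff_taylor_poly_le[OF f y] divide_right_mono[OF assms(5), of "fact (Suc d)"]
          by (simp del: fact_Suc)
        ultimately show "y \<in> {x. \<bar>?P x\<bar> \<le> 1 + 1 / fact (Suc d)}" unfolding mem_Collect_eq by argo
      qed
      ultimately have "closure (ball 0 1) \<subseteq> {x. \<bar>?P x\<bar> \<le> 1 + 1 / fact (Suc d)}"
        by (rule closure_minimal[rotated])
      with x show "(\<Sum>bs\<in>multi_dirs 0. \<bar>iter_partial (cball 0 1) bs ?P x\<bar>) \<le> 1 + 1 / fact (Suc d)"
        by auto
    qed simp
    then have "C * M 0 ?P \<le> C3 d C"
      using C1 mult_left_mono[of "M 0 ?P" "1 + 1 / fact (Suc d)" C] unfolding C3 by linarith
    moreover have "M (Suc (Suc 0)) ?P \<le> C * M 0 ?P"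
      using C poly_deg_le_taylor_poly[of d f] False d unfolding poly_deriv_bound_def by auto
    moreover have "(\<Sum>bs\<in>multi_dirs (Suc (Suc 0)). \<bar>iter_partial (cball 0 1) bs ?P z\<bar>) \<le> M (Suc (Suc 0)) ?P"
      by (rule sum_abs_iter_partial_le_M[OF Ck_on_taylor_poly[OF D] z])
    ultimately show ?thesis using eq by simp
  qed
qed

section \<open>Normal coordinates along the zero set\<close>

lemma grad_on_eq:
  assumes "solid U" "x \<in> U" "(g has_derivative (\<lambda>h. v \<bullet> h)) (at x within U)"
  shows "grad_on U g x = v"
  unfolding grad_on_def using partial_deriv_eq[OF assms]
  by (simp add: euclidean_representation)

lemma gradient_line_derivative:
  fixes g :: "'a::real_inner \<Rightarrow> real"
  assumes "(g has_derivative (\<lambda>h. v \<bullet> h)) (at (y + t *\<^sub>R w))"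
  shows "((\<lambda>t. g (y + t *\<^sub>R w)) has_real_derivative v \<bullet> w) (at t)"
proof -
  have "((\<lambda>t. y + t *\<^sub>R w) has_derivative (\<lambda>h. h *\<^sub>R w)) (at t)"
    by (auto intro!: derivative_eq_intros)
  from has_derivative_compose[OF this assms]
  show ?thesis by (simp add: has_field_derivative_def mult_commute_abs)
qed

text \<open>\<open>\<phi>\<close> and \<open>\<nu>\<close> are the gradients of \<open>f\<close> and \<open>P\<close>, \<open>\<nu>'\<close> is the Hessian of \<open>P\<close>, and \<open>K\<close> stands for \<open>C3\<close>.\<close>

locale close_defining_functions =
  fixes f P :: "'a::euclidean_space \<Rightarrow> real" and \<phi> \<nu> :: "'a \<Rightarrow> 'a" and \<nu>' :: "'a \<Rightarrow> 'a \<Rightarrow> 'a"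
    and \<gamma> K :: real and m :: nat
  assumes K: "2 \<le> K" and \<gamma>_pos: "0 < \<gamma>" and \<gamma>_less: "\<gamma> < 1"
    and Ck_P: "\<And>j. Ck_on j UNIV P" and Ck_\<nu>: "\<And>j. Ck_on j UNIV \<nu>"
    and Ck_f: "Ck_on (Suc m) (ball 0 1) f"
    and dP: "\<And>x. (P has_derivative (\<lambda>h. \<nu> x \<bullet> h)) (at x)"
    and df: "\<And>x. x \<in> ball 0 1 \<Longrightarrow> (f has_derivative (\<lambda>h. \<phi> x \<bullet> h)) (at x)"
    and d\<nu>: "\<And>x. (\<nu> has_derivative \<nu>' x) (at x)"
    and \<nu>'_le: "\<And>x h. x \<in> ball 0 1 \<Longrightarrow> norm (\<nu>' x h) \<le> K * norm h"
    and near: "\<And>x. x \<in> ball 0 1 \<Longrightarrow> \<bar>f x - P x\<bar> \<le> \<gamma>\<^sup>2 / (8 * K)"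
    and grad_near: "\<And>x. x \<in> ball 0 1 \<Longrightarrow> norm (\<phi> x - \<nu> x) \<le> \<gamma> / 8"
    and zero_norm_le: "\<And>x. x \<in> cball 0 1 \<Longrightarrow> f x = 0 \<Longrightarrow> norm x \<le> 1 / 2"
    and zero_regular: "\<And>x. x \<in> cball 0 1 \<Longrightarrow> f x = 0 \<Longrightarrow> \<gamma> \<le> norm (\<phi> x)"
begin

section \<open>The domain of the normal coordinates and the two maps on it\<close>

lemma K_pos: "0 < K" using K by simp

lemma lipschitz_\<nu>:
  assumes "x \<in> ball 0 1" "y \<in> ball 0 1"
  shows "norm (\<nu> x - \<nu> y) \<le> K * norm (x - y)"
  using assms has_derivative_at_withinI[OF d\<nu>] \<nu>'_le
  by (intro differentiable_bound[of "ball 0 1" \<nu> \<nu>' K]) (auto intro: onorm_le)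

text \<open>The strict inequalities make the set open. The radius 3/4 leaves room for a step shorter
  than 3/16 inside the unit ball. The lower bound \<gamma>/2 keeps the normal nonzero and converts
  the length bound into \<bar>s\<bar> K < 3/4. The length 3\<gamma>/(8K) exceeds \<gamma>/(4K), the
  distance within which a zero of f finds a zero of P, and lets \<nu> change by at most 3\<gamma>/8
  along the normal.\<close>

definition \<Omega> :: "('a \<times> real) set" where
  "\<Omega> = {p. norm (fst p) < 3 / 4 \<and> \<gamma> / 2 < norm (\<nu> (fst p)) \<and> \<bar>snd p\<bar> * norm (\<nu> (fst p)) < 3 * \<gamma> / (8 * K)}"

text \<open>The normal map alone drops one dimension; recording the level \<open>P y\<close>
  restores it. All level sets of P are treated at once, and the slice with second component 0 is the
  tubular map of the zero set.\<close>

definition G :: "'a \<times> real \<Rightarrow> 'a \<times> real" where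
  "G p = (fst p + snd p *\<^sub>R \<nu> (fst p), P (fst p))"

text \<open>The slice with second component 0 describes where the normal line through
  \<open>y\<close> meets the zero set of f, for all \<open>y\<close> and not only for zeros of
  P.\<close>

definition F :: "'a \<times> real \<Rightarrow> 'a \<times> real" where
  "F p = (fst p, f (fst p + snd p *\<^sub>R \<nu> (fst p)))"

lemma cont_\<nu>: "continuous_on S \<nu>"
  using Ck_on_continuous[OF Ck_\<nu>] continuous_on_subset by blast

lemma cont_P: "continuous_on S P"
  using Ck_on_continuous[OF Ck_P] continuous_on_subset by blast

lemma open_\<Omega>: "open \<Omega>"
  unfolding \<Omega>_def
  by (intro open_Collect_conj open_Collect_less continuous_intros continuous_on_compose2[OF cont_\<nu>]) auto

text \<open>The fibre over \<open>y\<close> is a symmetric interval: sliding along the normal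
  towards \<open>y\<close> never leaves the domain.\<close>

lemma \<Omega>_shrink:
  assumes "(y, s) \<in> \<Omega>" "\<bar>t\<bar> \<le> \<bar>s\<bar>" shows "(y, t) \<in> \<Omega>"
  using assms mult_right_mono[OF assms(2), of "norm (\<nu> y)"] by (simp add: \<Omega>_def)

lemma \<Omega>_step: "3 * \<gamma> / (8 * K) \<le> 3 / 16"
proof -
  have "3 * \<gamma> \<le> 3 / 16 * (8 * K)" using \<gamma>_less K by linarith
  then show ?thesis using K_pos by (simp add: pos_divide_le_eq)
qed

lemma \<Omega>_ball:
  assumes "(y, s) \<in> \<Omega>"
  shows "y \<in> ball 0 1" "y + s *\<^sub>R \<nu> y \<in> ball 0 1"
proof -
  show "y \<in> ball 0 1" using assms by (simp add: \<Omega>_def)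
  have "norm (y + s *\<^sub>R \<nu> y) \<le> norm y + \<bar>s\<bar> * norm (\<nu> y)"
    using norm_triangle_ineq[of y "s *\<^sub>R \<nu> y"] by simp
  also have "\<dots> < 1" using assms \<Omega>_step by (simp add: \<Omega>_def)
  finally show "y + s *\<^sub>R \<nu> y \<in> ball 0 1" by simp
qed

text \<open>As \<open>K\<close> is a Lipschitz constant of \<nu>, a product \<bar>s\<bar> K below 1
  prevents nearby normals from focusing.\<close>

lemma \<Omega>_small:
  assumes "(y, s) \<in> \<Omega>" shows "\<bar>s\<bar> * K < 3 / 4"
proof -
  have "\<bar>s\<bar> * (\<gamma> / 2) \<le> \<bar>s\<bar> * norm (\<nu> y)"
    using assms by (intro mult_left_mono) (auto simp: \<Omega>_def)
  also have "\<dots> < 3 * \<gamma> / (8 * K)" using assms by (simp add: \<Omega>_def)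
  finally have "\<bar>s\<bar> * (\<gamma> / 2) * (8 * K) < 3 * \<gamma>"
    using K_pos by (simp add: pos_less_divide_eq mult_ac)
  moreover have "\<bar>s\<bar> * (\<gamma> / 2) * (8 * K) = \<gamma> * (\<bar>s\<bar> * K * 4)" by simp
  ultimately have "\<gamma> * (\<bar>s\<bar> * K * 4) < \<gamma> * 3" by linarith
  then show ?thesis using \<gamma>_pos by simp
qed

text \<open>
  If \<open>G (y, s) = G (y', s')\<close> and \<open>w = y' - y\<close>, then \<open>\<nu> \<xi>\<close> is orthogonal to \<open>w\<close> at some point \<open>\<xi>\<close> of
  the segment from \<open>y\<close> to \<open>y'\<close>. Comparing \<open>\<nu> y\<close> and \<open>\<nu> y'\<close> with \<open>\<nu> \<xi>\<close> gives
  \<open>\<bar>w\<bar>\<^sup>2 \<le> max \<bar>s\<bar> \<bar>s'\<bar> K \<bar>w\<bar>\<^sup>2\<close>, where the factor is below \<open>3 / 4\<close>.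
\<close>

lemma inj_G: "inj_on G \<Omega>"
proof (rule inj_onI, clarify)
  fix y s y' s'
  assume O: "(y, s) \<in> \<Omega>" "(y', s') \<in> \<Omega>" and eq: "G (y, s) = G (y', s')"
  define w where "w = y' - y"
  have yy: "y \<in> ball 0 1" "y' \<in> ball 0 1" using \<Omega>_ball O by auto
  have P_eq: "P y = P y'" and w: "w = s *\<^sub>R \<nu> y - s' *\<^sub>R \<nu> y'"
    using eq by (auto simp: G_def w_def algebra_simps)
  have "((\<lambda>t. P (y + t *\<^sub>R w)) has_real_derivative \<nu> (y + t *\<^sub>R w) \<bullet> w) (at t)" for t
    by (rule gradient_line_derivative[OF dP])
  then obtain t where t: "0 < t" "t < 1" "P (y + 1 *\<^sub>R w) - P (y + 0 *\<^sub>R w) = (1 - 0) * (\<nu> (y + t *\<^sub>R w) \<bullet> w)"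
    using MVT2[of 0 1 "\<lambda>t. P (y + t *\<^sub>R w)" "\<lambda>t. \<nu> (y + t *\<^sub>R w) \<bullet> w"] by auto
  define \<xi> where "\<xi> = y + t *\<^sub>R w"
  have \<nu>\<xi>: "\<nu> \<xi> \<bullet> w = 0" using t P_eq by (simp add: \<xi>_def w_def)
  have "\<xi> = (1 - t) *\<^sub>R y + t *\<^sub>R y'" by (simp add: \<xi>_def w_def algebra_simps)
  then have \<xi>: "\<xi> \<in> ball 0 1"
    using convexD[OF convex_ball yy, of "1 - t" t] t by auto
  have d1: "norm (\<nu> y - \<nu> \<xi>) \<le> K * (t * norm w)"
    using lipschitz_\<nu>[OF yy(1) \<xi>] t by (simp add: \<xi>_def)
  have "y' - \<xi> = (1 - t) *\<^sub>R w" by (simp add: \<xi>_def w_def algebra_simps)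
  then have d2: "norm (\<nu> y' - \<nu> \<xi>) \<le> K * ((1 - t) * norm w)"
    using lipschitz_\<nu>[OF yy(2) \<xi>] t by simp
  have b1: "\<bar>s * ((\<nu> y - \<nu> \<xi>) \<bullet> w)\<bar> \<le> 3 / 4 * (t * norm w * norm w)"
  proof -
    have "\<bar>s * ((\<nu> y - \<nu> \<xi>) \<bullet> w)\<bar> \<le> \<bar>s\<bar> * (K * (t * norm w) * norm w)"
      unfolding abs_mult using t
      by (intro mult_left_mono order_trans[OF Cauchy_Schwarz_ineq2] mult_right_mono d1) auto
    also have "\<dots> = \<bar>s\<bar> * K * (t * norm w * norm w)" by simp
    also have "\<dots> \<le> 3 / 4 * (t * norm w * norm w)"
      using \<Omega>_small[OF O(1)] t by (intro mult_right_mono) auto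
    finally show ?thesis .
  qed
  have b2: "\<bar>s' * ((\<nu> y' - \<nu> \<xi>) \<bullet> w)\<bar> \<le> 3 / 4 * ((1 - t) * norm w * norm w)"
  proof -
    have "\<bar>s' * ((\<nu> y' - \<nu> \<xi>) \<bullet> w)\<bar> \<le> \<bar>s'\<bar> * (K * ((1 - t) * norm w) * norm w)"
      unfolding abs_mult using t
      by (intro mult_left_mono order_trans[OF Cauchy_Schwarz_ineq2] mult_right_mono d2) auto
    also have "\<dots> = \<bar>s'\<bar> * K * ((1 - t) * norm w * norm w)" by simp
    also have "\<dots> \<le> 3 / 4 * ((1 - t) * norm w * norm w)"
      using \<Omega>_small[OF O(2)] t by (intro mult_right_mono) auto
    finally show ?thesis .
  qed
  have "w \<bullet> w = s * (\<nu> y \<bullet> w) - s' * (\<nu> y' \<bullet> w)"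
    using arg_cong[OF w, of "\<lambda>v. v \<bullet> w"] by (simp add: inner_diff_left)
  also have "\<dots> = s * ((\<nu> y - \<nu> \<xi>) \<bullet> w) - s' * ((\<nu> y' - \<nu> \<xi>) \<bullet> w)"
    by (simp add: inner_diff_left \<nu>\<xi>)
  finally have "norm w * norm w = s * ((\<nu> y - \<nu> \<xi>) \<bullet> w) - s' * ((\<nu> y' - \<nu> \<xi>) \<bullet> w)"
    by (simp add: power2_norm_eq_inner[symmetric] power2_eq_square)
  \<comment> \<open>The weights t and 1 - t add up to 1, so the total factor stays at 3/4; bounding
    both distances to \<xi> by \<open>norm w\<close> would give 3/2.\<close>
  then have "norm w * norm w \<le> 3 / 4 * (t * norm w * norm w) + 3 / 4 * ((1 - t) * norm w * norm w)"
    using b1 b2 by linarith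
  also have "\<dots> = 3 / 4 * (norm w * norm w)" by (simp add: algebra_simps)
  finally have "norm w * norm w \<le> 0" by simp
  then have "w = 0" by (simp add: mult_le_0_iff)
  then have y: "y = y'" by (simp add: w_def)
  with w \<open>w = 0\<close> have "(s - s') *\<^sub>R \<nu> y = 0" by (auto simp: algebra_simps)
  moreover have "\<nu> y \<noteq> 0" using O(1) \<gamma>_pos by (auto simp: \<Omega>_def)
  ultimately show "y = y' \<and> s = s'" using y by simp
qed

text \<open>The gradients of f and P differ by at most \<gamma>/8, and the move along the normal
  costs at most 3\<gamma>/8. The total \<gamma>/2 is strictly less than the length of \<nu> y, and a
  vector closer to \<nu> y than that has positive inner product with it.\<close>

lemma gradient_transversal:
  assumes "(y, s) \<in> \<Omega>" shows "0 < \<phi> (y + s *\<^sub>R \<nu> y) \<bullet> \<nu> y"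
proof -
  let ?z = "y + s *\<^sub>R \<nu> y"
  have "norm (\<phi> ?z - \<nu> y) \<le> norm (\<phi> ?z - \<nu> ?z) + norm (\<nu> ?z - \<nu> y)"
    using norm_triangle_ineq[of "\<phi> ?z - \<nu> ?z" "\<nu> ?z - \<nu> y"] by simp
  also have "\<dots> \<le> \<gamma> / 8 + K * (\<bar>s\<bar> * norm (\<nu> y))"
    using grad_near[OF \<Omega>_ball(2)[OF assms]] lipschitz_\<nu>[OF \<Omega>_ball(2,1)[OF assms]] by simp
  also have "\<dots> \<le> \<gamma> / 8 + K * (3 * \<gamma> / (8 * K))"
    using assms K_pos by (intro add_left_mono mult_left_mono) (auto simp: \<Omega>_def)
  also have "\<dots> = \<gamma> / 2" using K_pos by simp
  also have "\<dots> < norm (\<nu> y)" using assms by (simp add: \<Omega>_def)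
  finally have *: "norm (\<phi> ?z - \<nu> y) < norm (\<nu> y)" .
  then have "0 < norm (\<nu> y)" using norm_ge_zero[of "\<phi> ?z - \<nu> y"] by linarith
  have "\<bar>(\<phi> ?z - \<nu> y) \<bullet> \<nu> y\<bar> \<le> norm (\<phi> ?z - \<nu> y) * norm (\<nu> y)" by (rule Cauchy_Schwarz_ineq2)
  also have "\<dots> < norm (\<nu> y) * norm (\<nu> y)" using * \<open>0 < norm (\<nu> y)\<close> by (rule mult_strict_right_mono)
  also have "\<dots> = \<nu> y \<bullet> \<nu> y" by (simp add: power2_norm_eq_inner[symmetric] power2_eq_square)
  finally show ?thesis by (simp add: inner_diff_left)
qed

text \<open>The first component fixes \<open>y\<close>, and by transversality f strictly increases
  along the fibre, which is an interval.\<close>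

lemma inj_F: "inj_on F \<Omega>"
proof (rule inj_onI, clarify)
  fix y s y' s'
  assume O: "(y, s) \<in> \<Omega>" "(y', s') \<in> \<Omega>" and eq: "F (y, s) = F (y', s')"
  then have y: "y' = y" and feq: "f (y + s *\<^sub>R \<nu> y) = f (y + s' *\<^sub>R \<nu> y)" by (auto simp: F_def)
  have less: "f (y + a *\<^sub>R \<nu> y) < f (y + b *\<^sub>R \<nu> y)" if "(y, a) \<in> \<Omega>" "(y, b) \<in> \<Omega>" "a < b" for a b
  proof (rule DERIV_pos_imp_increasing[OF that(3)])
    fix t assume "a \<le> t" "t \<le> b"
    then have "\<bar>t\<bar> \<le> max \<bar>a\<bar> \<bar>b\<bar>" by auto
    then have t: "(y, t) \<in> \<Omega>" using \<Omega>_shrink that by (metis max_def)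
    have "((\<lambda>t. f (y + t *\<^sub>R \<nu> y)) has_real_derivative \<phi> (y + t *\<^sub>R \<nu> y) \<bullet> \<nu> y) (at t)"
      by (rule gradient_line_derivative[OF df[OF \<Omega>_ball(2)[OF t]]])
    then show "\<exists>D. ((\<lambda>t. f (y + t *\<^sub>R \<nu> y)) has_real_derivative D) (at t) \<and> D > 0"
      using gradient_transversal[OF t] by blast
  qed
  then show "y = y' \<and> s = s'"
    using O feq y by (metis less_irrefl linorder_neqE_linordered_idom)
qed

lemma solid_\<Omega>: "solid \<Omega>" using solid_open[OF open_\<Omega>] .

section \<open>Smoothness of the two maps and of their inverses\<close>

lemma Ck_normal_map: "Ck_on j \<Omega> (\<lambda>p. fst p + snd p *\<^sub>R \<nu> (fst p))"
  by (intro Ck_on_add Ck_on_scaleR solid_\<Omega> Ck_on_linear bounded_linear_fst bounded_linear_snd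
      Ck_on_compose[OF solid_\<Omega> solid_open[OF open_UNIV] Ck_\<nu>]) simp

lemma Ck_G: "Ck_on j \<Omega> G"
  unfolding G_def[abs_def]
  by (intro Ck_on_Pair solid_\<Omega> Ck_normal_map
      Ck_on_compose[OF solid_\<Omega> solid_open[OF open_UNIV] Ck_P] Ck_on_linear bounded_linear_fst) simp

lemma Ck_F: "Ck_on (Suc m) \<Omega> F"
  unfolding F_def[abs_def]
  by (intro Ck_on_Pair solid_\<Omega> Ck_on_linear bounded_linear_fst
      Ck_on_compose[OF solid_\<Omega> solid_open[OF open_ball] Ck_f Ck_normal_map])
    (use \<Omega>_ball(2) in auto)

lemma normal_map_has_derivative:
  "((\<lambda>p. fst p + snd p *\<^sub>R \<nu> (fst p)) has_derivative
    (\<lambda>h. fst h + (snd p *\<^sub>R \<nu>' (fst p) (fst h) + snd h *\<^sub>R \<nu> (fst p)))) (at p)"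
  by (intro has_derivative_add has_derivative_scaleR has_derivative_fst has_derivative_snd has_derivative_ident
      has_derivative_compose[OF _ d\<nu>])

lemma G_inverse:
  shows "open (G ` \<Omega>)" "Ck_on (Suc j) (G ` \<Omega>) (inv_into \<Omega> G)"
proof -
  let ?D = "\<lambda>p h. (fst h + (snd p *\<^sub>R \<nu>' (fst p) (fst h) + snd h *\<^sub>R \<nu> (fst p)), \<nu> (fst p) \<bullet> fst h)"
  have d: "(G has_derivative ?D p) (at p)" for p
    unfolding G_def[abs_def]
    by (intro has_derivative_Pair normal_map_has_derivative has_derivative_compose[OF _ dP]
        has_derivative_fst has_derivative_ident)
  have ker: "h = 0" if p: "p \<in> \<Omega>" and "?D p h = 0" for p h
  proof -
    obtain y s where ys: "p = (y, s)" by (cases p)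
    obtain u \<sigma> where h: "h = (u, \<sigma>)" by (cases h)
    have 1: "u + s *\<^sub>R \<nu>' y u + \<sigma> *\<^sub>R \<nu> y = 0" and 2: "\<nu> y \<bullet> u = 0"
      using that(2) by (auto simp: ys h zero_prod_def add.assoc)
    have "u \<bullet> u + s * (\<nu>' y u \<bullet> u) = 0"
      using arg_cong[OF 1, of "\<lambda>v. v \<bullet> u"] 2 by (simp add: inner_add_left)
    moreover have "\<bar>s * (\<nu>' y u \<bullet> u)\<bar> \<le> 3 / 4 * (norm u * norm u)"
    proof -
      have "\<bar>s * (\<nu>' y u \<bullet> u)\<bar> \<le> \<bar>s\<bar> * (K * norm u * norm u)"
        unfolding abs_mult using \<nu>'_le[OF \<Omega>_ball(1)] p ys
        by (intro mult_left_mono order_trans[OF Cauchy_Schwarz_ineq2] mult_right_mono) auto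
      also have "\<dots> = \<bar>s\<bar> * K * (norm u * norm u)" by simp
      also have "\<dots> \<le> 3 / 4 * (norm u * norm u)"
        using \<Omega>_small[of y s] p ys by (intro mult_right_mono) auto
      finally show ?thesis .
    qed
    moreover have "u \<bullet> u = norm u * norm u" by (simp add: power2_norm_eq_inner[symmetric] power2_eq_square)
    ultimately have "norm u * norm u \<le> 0" by linarith
    then have u: "u = 0" by (simp add: mult_le_0_iff)
    moreover have "\<nu>' y 0 = 0" using linear_0 has_derivative_linear[OF d\<nu>] by blast
    ultimately have "\<sigma> *\<^sub>R \<nu> y = 0" using 1 by simp
    moreover have "\<nu> y \<noteq> 0" using p ys \<gamma>_pos by (auto simp: \<Omega>_def)
    ultimately show ?thesis using u h by (simp add: zero_prod_def)
  qed
  show "open (G ` \<Omega>)" "Ck_on (Suc j) (G ` \<Omega>) (inv_into \<Omega> G)"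
    by (rule Ck_on_inv_into[where G' = ?D, OF open_\<Omega> Ck_G inj_G]; (rule d | rule ker; assumption))+
qed

text \<open>The derivative is block triangular, with the positive number from
  \<open>gradient_transversal\<close> as its last diagonal entry.\<close>

lemma F_inverse:
  shows "open (F ` \<Omega>)" "Ck_on (Suc m) (F ` \<Omega>) (inv_into \<Omega> F)"
proof -
  let ?n = "\<lambda>p h. fst h + (snd p *\<^sub>R \<nu>' (fst p) (fst h) + snd h *\<^sub>R \<nu> (fst p))"
  let ?D = "\<lambda>p h. (fst h, \<phi> (fst p + snd p *\<^sub>R \<nu> (fst p)) \<bullet> ?n p h)"
  have d: "(F has_derivative ?D p) (at p)" if "p \<in> \<Omega>" for p
    unfolding F_def[abs_def]
    by (intro has_derivative_Pair has_derivative_compose[OF normal_map_has_derivative]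
        has_derivative_fst has_derivative_ident df) (use \<Omega>_ball(2)[of "fst p" "snd p"] that in simp)
  have ker: "h = 0" if p: "p \<in> \<Omega>" and "?D p h = 0" for p h
  proof -
    obtain y s where ys: "p = (y, s)" by (cases p)
    obtain u \<sigma> where h: "h = (u, \<sigma>)" by (cases h)
    have "\<nu>' y 0 = 0" using linear_0 has_derivative_linear[OF d\<nu>] by blast
    then have "u = 0" "\<sigma> * (\<phi> (y + s *\<^sub>R \<nu> y) \<bullet> \<nu> y) = 0"
      using that(2) by (auto simp: ys h zero_prod_def)
    then show ?thesis using gradient_transversal[of y s] p ys h by (simp add: zero_prod_def)
  qed
  show "open (F ` \<Omega>)" "Ck_on (Suc m) (F ` \<Omega>) (inv_into \<Omega> F)"
    by (rule Ck_on_inv_into[where G' = ?D, OF open_\<Omega> Ck_F inj_F]; (rule d ker; assumption))+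
qed

section \<open>The projection and the map back along the normals\<close>

text \<open>The foot on the zero set of P of the normal through \<open>x\<close>; the value is
  meaningful on \<open>N\<^sub>\<pi>\<close> only.\<close>

definition \<pi> :: "'a \<Rightarrow> 'a" where "\<pi> x = fst (inv_into \<Omega> G (x, 0))"
definition \<epsilon> :: "'a \<Rightarrow> 'a" where "\<epsilon> y = y + snd (inv_into \<Omega> F (y, 0)) *\<^sub>R \<nu> y"
definition N\<^sub>\<pi> :: "'a set" where "N\<^sub>\<pi> = {x. (x, 0) \<in> G ` \<Omega>}"
text \<open>An open set of the ambient space, of which the zeros of P form only a slice. This is
  what later gives relative openness in \<open>Y0 P\<close>.\<close>

definition N\<^sub>\<epsilon> :: "'a set" where "N\<^sub>\<epsilon> = {y. (y, 0) \<in> F ` \<Omega>}"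

lemma \<pi>_normal:
  assumes "(y, s) \<in> \<Omega>" "P y = 0"
  shows "y + s *\<^sub>R \<nu> y \<in> N\<^sub>\<pi>" "\<pi> (y + s *\<^sub>R \<nu> y) = y"
proof -
  have G: "G (y, s) = (y + s *\<^sub>R \<nu> y, 0)" using assms by (simp add: G_def)
  then show "y + s *\<^sub>R \<nu> y \<in> N\<^sub>\<pi>" using assms(1) unfolding N\<^sub>\<pi>_def by (metis imageI mem_Collect_eq)
  have "inv_into \<Omega> G (G (y, s)) = (y, s)" by (rule inv_into_f_f[OF inj_G assms(1)])
  then show "\<pi> (y + s *\<^sub>R \<nu> y) = y" by (simp add: \<pi>_def G)
qed

lemma \<pi>_obtain:
  assumes "x \<in> N\<^sub>\<pi>"
  obtains s where "(\<pi> x, s) \<in> \<Omega>" "P (\<pi> x) = 0" "x = \<pi> x + s *\<^sub>R \<nu> (\<pi> x)"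
proof -
  obtain y s where ys: "(y, s) \<in> \<Omega>" "(x, 0) = G (y, s)" using assms by (auto simp: N\<^sub>\<pi>_def)
  then have "P y = 0" "x = y + s *\<^sub>R \<nu> y" by (auto simp: G_def)
  moreover from this have "\<pi> x = y" using \<pi>_normal(2)[OF ys(1)] by simp
  ultimately show ?thesis using that ys(1) by simp
qed

lemma \<epsilon>_normal:
  assumes "(y, s) \<in> \<Omega>" "f (y + s *\<^sub>R \<nu> y) = 0"
  shows "y \<in> N\<^sub>\<epsilon>" "\<epsilon> y = y + s *\<^sub>R \<nu> y"
proof -
  have F: "F (y, s) = (y, 0)" using assms by (simp add: F_def)
  then show "y \<in> N\<^sub>\<epsilon>" using assms(1) unfolding N\<^sub>\<epsilon>_def by (metis imageI mem_Collect_eq)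
  have "inv_into \<Omega> F (F (y, s)) = (y, s)" by (rule inv_into_f_f[OF inj_F assms(1)])
  then show "\<epsilon> y = y + s *\<^sub>R \<nu> y" by (simp add: \<epsilon>_def F)
qed

lemma \<epsilon>_obtain:
  assumes "y \<in> N\<^sub>\<epsilon>"
  obtains s where "(y, s) \<in> \<Omega>" "f (\<epsilon> y) = 0" "\<epsilon> y = y + s *\<^sub>R \<nu> y"
proof -
  obtain s where ys: "(y, s) \<in> \<Omega>" "f (y + s *\<^sub>R \<nu> y) = 0" using assms by (auto simp: N\<^sub>\<epsilon>_def F_def)
  then show ?thesis using that \<epsilon>_normal[OF ys] by simp
qed

lemma \<epsilon>_in_Y0: "y \<in> N\<^sub>\<epsilon> \<Longrightarrow> \<epsilon> y \<in> Y0 f"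
proof -
  assume y: "y \<in> N\<^sub>\<epsilon>"
  obtain s where s: "(y, s) \<in> \<Omega>" "f (\<epsilon> y) = 0" "\<epsilon> y = y + s *\<^sub>R \<nu> y" using \<epsilon>_obtain[OF y] .
  then show "\<epsilon> y \<in> Y0 f" using \<Omega>_ball(2)[OF s(1)] by (simp add: Y0_def)
qed

lemma open_vimage_zero_section: "open A \<Longrightarrow> open {x. (x, 0::real) \<in> A}"
  using open_vimage[of A "\<lambda>x. (x, 0)"] by (simp add: vimage_def continuous_intros)

lemma open_N\<^sub>\<pi>: "open N\<^sub>\<pi>" and open_N\<^sub>\<epsilon>: "open N\<^sub>\<epsilon>"
  unfolding N\<^sub>\<pi>_def N\<^sub>\<epsilon>_def by (intro open_vimage_zero_section G_inverse F_inverse)+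

lemma Ck_zero_section: "solid A \<Longrightarrow> Ck_on j A (\<lambda>x. (x, 0::real))"
  by (intro Ck_on_Pair Ck_on_id Ck_on_const)

lemma Ck_\<pi>: "Ck_on (Suc j) N\<^sub>\<pi> \<pi>"
  unfolding \<pi>_def[abs_def]
  by (intro Ck_on_bounded_linear[OF _ bounded_linear_fst] solid_open open_N\<^sub>\<pi> Ck_zero_section
      Ck_on_compose[OF _ solid_open[OF G_inverse(1)] G_inverse(2)]) (auto simp: N\<^sub>\<pi>_def)

lemma Ck_\<epsilon>: "Ck_on (Suc m) N\<^sub>\<epsilon> \<epsilon>"
  unfolding \<epsilon>_def[abs_def]
  by (intro Ck_on_add Ck_on_scaleR Ck_on_id Ck_on_bounded_linear[OF _ bounded_linear_snd] solid_open open_N\<^sub>\<epsilon>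
      Ck_zero_section Ck_on_compose[OF _ solid_open[OF F_inverse(1)] F_inverse(2)]
      Ck_on_subset[OF _ subset_UNIV Ck_\<nu>]) (auto simp: N\<^sub>\<epsilon>_def)

section \<open>Zeros of f on normals of the zero set of P\<close>

text \<open>At \<open>x\<close> the vector \<nu> has length at least 7\<gamma>/8, and it changes by
  at most \<gamma>/4 within distance \<gamma>/(4K). Along the line in its direction P therefore has
  slope at least 5\<gamma>/8 and moves by at least 5/32 of \<gamma>^2/K on either side, more than
  the possible value 4/32 of \<gamma>^2/K at \<open>x\<close>. So P changes sign.\<close>

lemma zero_near_zero:
  assumes "x \<in> Y0 f"
  shows "\<exists>z. dist x z \<le> \<gamma> / (4 * K) \<and> P z = 0"
proof -
  define \<rho> where "\<rho> = \<gamma> / (4 * K)"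
  have \<rho>: "0 < \<rho>" "\<rho> \<le> 1 / 8" "K * \<rho> = \<gamma> / 4"
    using \<gamma>_pos \<gamma>_less K by (auto simp: \<rho>_def divide_simps)
  have x: "norm x \<le> 1 / 2" "f x = 0" "\<gamma> \<le> norm (\<phi> x)"
    using assms zero_norm_le zero_regular by (auto simp: Y0_def)
  then have xb: "x \<in> ball 0 1" by simp
  have \<nu>x: "7 / 8 * \<gamma> \<le> norm (\<nu> x)"
    using grad_near[OF xb] norm_triangle_ineq2[of "\<phi> x" "\<nu> x"] x(3) by linarith
  then have pos: "0 < norm (\<nu> x)" using \<gamma>_pos by linarith
  define n where "n = \<nu> x /\<^sub>R norm (\<nu> x)"
  have n: "norm n = 1" "\<nu> x \<bullet> n = norm (\<nu> x)"
    using pos by (simp_all add: n_def power2_norm_eq_inner[symmetric] power2_eq_square)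
  have dxt: "dist x (x + t *\<^sub>R n) = \<bar>t\<bar>" for t using n by (simp add: dist_norm)
  have slope: "5 / 8 * \<gamma> \<le> \<nu> (x + t *\<^sub>R n) \<bullet> n" if t: "\<bar>t\<bar> \<le> \<rho>" for t
  proof -
    have "norm (x + t *\<^sub>R n) \<le> norm x + \<bar>t\<bar>" using norm_triangle_ineq[of x "t *\<^sub>R n"] n by simp
    then have "x + t *\<^sub>R n \<in> ball 0 1" using x \<rho> t by simp
    then have "norm (\<nu> (x + t *\<^sub>R n) - \<nu> x) \<le> K * \<bar>t\<bar>"
      using lipschitz_\<nu>[OF _ xb, of "x + t *\<^sub>R n"] n by simp
    also have "\<dots> \<le> \<gamma> / 4" using mult_left_mono[OF t, of K] K_pos \<rho> by simp
    finally have "\<bar>(\<nu> (x + t *\<^sub>R n) - \<nu> x) \<bullet> n\<bar> \<le> \<gamma> / 4"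
      using Cauchy_Schwarz_ineq2[of "\<nu> (x + t *\<^sub>R n) - \<nu> x" n] n by simp
    then show ?thesis using n(2) \<nu>x unfolding inner_diff_left by linarith
  qed
  have deriv: "((\<lambda>t. P (x + t *\<^sub>R n)) has_real_derivative \<nu> (x + t *\<^sub>R n) \<bullet> n) (at t)" for t
    by (rule gradient_line_derivative[OF dP])
  have "\<bar>P x\<bar> \<le> \<gamma>\<^sup>2 / (8 * K)" using near[OF xb] x by simp
  also have "\<gamma>\<^sup>2 / (8 * K) < \<rho> * (5 / 8 * \<gamma>)"
    using \<gamma>_pos K by (simp add: \<rho>_def power2_eq_square divide_simps)
  finally have Px: "\<bar>P x\<bar> < \<rho> * (5 / 8 * \<gamma>)" .
  obtain a where a: "0 < a" "a < \<rho>" "P (x + \<rho> *\<^sub>R n) - P (x + 0 *\<^sub>R n) = (\<rho> - 0) * (\<nu> (x + a *\<^sub>R n) \<bullet> n)"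
    using MVT2[OF \<rho>(1), of "\<lambda>t. P (x + t *\<^sub>R n)" "\<lambda>t. \<nu> (x + t *\<^sub>R n) \<bullet> n"] deriv by blast
  obtain b where b: "- \<rho> < b" "b < 0" "P (x + 0 *\<^sub>R n) - P (x + (- \<rho>) *\<^sub>R n) = (0 - - \<rho>) * (\<nu> (x + b *\<^sub>R n) \<bullet> n)"
    using MVT2[of "- \<rho>" 0 "\<lambda>t. P (x + t *\<^sub>R n)" "\<lambda>t. \<nu> (x + t *\<^sub>R n) \<bullet> n"] deriv \<rho>(1) by auto
  have "\<rho> * (5 / 8 * \<gamma>) \<le> \<rho> * (\<nu> (x + a *\<^sub>R n) \<bullet> n)" "\<rho> * (5 / 8 * \<gamma>) \<le> \<rho> * (\<nu> (x + b *\<^sub>R n) \<bullet> n)"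
    using slope[of a] slope[of b] a b \<rho> by (auto intro!: mult_left_mono)
  then have "P (x + (- \<rho>) *\<^sub>R n) \<le> 0" "0 \<le> P (x + \<rho> *\<^sub>R n)" using a(3) b(3) Px by auto
  moreover have "continuous_on {- \<rho>..\<rho>} (\<lambda>t. P (x + t *\<^sub>R n))"
    by (intro continuous_on_compose2[OF cont_P[of UNIV]] continuous_intros) auto
  ultimately obtain t where t: "- \<rho> \<le> t" "t \<le> \<rho>" "P (x + t *\<^sub>R n) = 0"
    using IVT'[of "\<lambda>t. P (x + t *\<^sub>R n)" "- \<rho>" 0 \<rho>] \<rho>(1) by auto
  then show ?thesis using dxt[of t] unfolding \<rho>_def[symmetric] by (intro exI[of _ "x + t *\<^sub>R n"]) auto
qed

text \<open>A nearest zero \<open>y\<close> of \<open>P\<close> to \<open>x\<close>: as \<open>P\<close> has constant sign on the ball around \<open>x\<close> through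
  \<open>y\<close>, it attains an extremum over the closed ball at \<open>y\<close>, so \<open>\<nu> y\<close> points along \<open>x - y\<close>.\<close>

lemma nearest_zero_normal:
  assumes r: "r = dist x y" "0 < r" and y: "P y = 0" "\<nu> y \<noteq> 0"
    and near: "\<And>z. dist x z < r \<Longrightarrow> P z \<noteq> 0"
  shows "\<exists>s. x = y + s *\<^sub>R \<nu> y \<and> \<bar>s\<bar> * norm (\<nu> y) = r"
proof -
  \<comment> \<open>The sign \<sigma> turns both cases into one: \<sigma> P is nonnegative on the
    ball and vanishes at \<open>y\<close>.\<close>
  have "\<exists>\<sigma>::real. \<bar>\<sigma>\<bar> = 1 \<and> (\<forall>z\<in>ball x r. 0 \<le> \<sigma> * P z)"
  proof (cases "\<exists>z\<in>ball x r. P z < 0")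
    case True
    then obtain z where z: "z \<in> ball x r" "P z < 0" by blast
    have "P w \<le> 0" if "w \<in> ball x r" for w
    proof (rule ccontr)
      assume "\<not> P w \<le> 0"
      have "connected (P ` ball x r)" by (rule connected_continuous_image[OF cont_P connected_ball])
      from connectedD_interval[OF this imageI[OF z(1)] imageI[OF that], of 0] z(2) \<open>\<not> P w \<le> 0\<close>
      show False using near by auto
    qed
    then show ?thesis by (intro exI[of _ "-1"]) auto
  next
    case False
    then show ?thesis by (intro exI[of _ 1]) (auto simp: not_less)
  qed
  then obtain \<sigma> :: real where \<sigma>: "\<bar>\<sigma>\<bar> = 1" "\<And>z. z \<in> ball x r \<Longrightarrow> 0 \<le> \<sigma> * P z" by blast
  have nonneg: "0 \<le> \<sigma> * P z" if "z \<in> cball x r" for z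
  proof -
    have "closed {z. 0 \<le> \<sigma> * P z}" by (intro closed_Collect_le continuous_intros cont_P)
    then have "closure (ball x r) \<subseteq> {z. 0 \<le> \<sigma> * P z}" using \<sigma>(2) by (intro closure_minimal) auto
    then show ?thesis using that r(2) by auto
  qed
  \<comment> \<open>The linear form \<sigma> \<nu> y is smallest on the closed ball at
    \<open>z\<close>. Testing minimality at \<open>y\<close> against this one point already forces
    equality in the Cauchy-Schwarz inequality.\<close>
  define u where "u = - (\<sigma> / norm (\<nu> y)) *\<^sub>R \<nu> y"
  define z where "z = x + r *\<^sub>R u"
  have u: "norm u = 1" using \<sigma>(1) y(2) by (simp add: u_def)
  have z: "z \<in> cball x r" using u r(2) by (simp add: z_def dist_norm)
  have yc: "y \<in> cball x r" using r by simp
  have "0 \<le> \<sigma> * (\<nu> y \<bullet> (z - y))"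
  proof (rule ccontr)
    assume neg: "\<not> 0 \<le> \<sigma> * (\<nu> y \<bullet> (z - y))"
    have "((\<lambda>t. \<sigma> * P (y + t *\<^sub>R (z - y))) has_real_derivative \<sigma> * (\<nu> y \<bullet> (z - y))) (at 0)"
      using gradient_line_derivative[of P "\<nu> y" y 0 "z - y"] dP[of y] by (intro DERIV_cmult) simp
    from DERIV_neg_dec_right[OF this] neg obtain d
      where d: "d > 0" "\<And>h. 0 < h \<Longrightarrow> h < d \<Longrightarrow> \<sigma> * P (y + (0 + h) *\<^sub>R (z - y)) < \<sigma> * P (y + 0 *\<^sub>R (z - y))"
      by (auto simp: not_le)
    define h where "h = min (d / 2) 1"
    have h: "0 < h" "h < d" "h \<le> 1" using d(1) by (auto simp: h_def)
    have "y + h *\<^sub>R (z - y) = (1 - h) *\<^sub>R y + h *\<^sub>R z" by (simp add: algebra_simps)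
    then have "y + h *\<^sub>R (z - y) \<in> cball x r"
      using convexD[OF convex_cball yc z, of "1 - h" h] h by simp
    from nonneg[OF this] d(2)[OF h(1,2)] y(1) show False by simp
  qed
  then have "r * norm (\<nu> y) \<le> (\<sigma> *\<^sub>R \<nu> y) \<bullet> (x - y)"
  proof -
    have "\<sigma> * (\<nu> y \<bullet> u) = - (\<sigma> * \<sigma> * ((norm (\<nu> y))\<^sup>2 / norm (\<nu> y)))"
      by (simp add: u_def power2_norm_eq_inner)
    also have "\<sigma> * \<sigma> = 1" using \<sigma>(1) by (metis abs_mult_self_eq mult_1)
    finally have "\<sigma> * (\<nu> y \<bullet> u) = - norm (\<nu> y)" using y(2) by (simp add: power2_eq_square)
    then have "\<sigma> * (r * (\<nu> y \<bullet> u)) = - (r * norm (\<nu> y))"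
      unfolding mult.left_commute[of \<sigma> r] by simp
    then have "\<sigma> * (\<nu> y \<bullet> (z - y)) = \<sigma> * (\<nu> y \<bullet> (x - y)) - r * norm (\<nu> y)"
      unfolding z_def by (simp add: inner_diff_right inner_add_right algebra_simps)
    with \<open>0 \<le> \<sigma> * (\<nu> y \<bullet> (z - y))\<close> show ?thesis by simp
  qed
  moreover have n\<sigma>: "norm (\<sigma> *\<^sub>R \<nu> y) = norm (\<nu> y)" using \<sigma>(1) by simp
  moreover have nxy: "norm (x - y) = r" using r by (simp add: dist_norm)
  ultimately have "(\<sigma> *\<^sub>R \<nu> y) \<bullet> (x - y) = norm (\<sigma> *\<^sub>R \<nu> y) * norm (x - y)"
    using norm_cauchy_schwarz[of "\<sigma> *\<^sub>R \<nu> y" "x - y"] by (simp only: mult.commute)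
  then have "norm (\<nu> y) *\<^sub>R (x - y) = r *\<^sub>R (\<sigma> *\<^sub>R \<nu> y)"
    unfolding norm_cauchy_schwarz_eq unfolding n\<sigma> nxy .
  then have "x - y = (r * \<sigma> / norm (\<nu> y)) *\<^sub>R \<nu> y"
    using y(2) by (metis divide_inverse_commute divideR_right norm_eq_zero scaleR_scaleR)
  then show ?thesis
    using \<sigma>(1) r(2) y(2) by (intro exI[of _ "r * \<sigma> / norm (\<nu> y)"]) (auto simp: abs_mult algebra_simps)
qed

text \<open>The nearest zero of P is sought in the whole space, so no boundary case arises; the
  distance estimate then places it in the ball of radius 3/4. There \<nu> has lost at most
  \<gamma>/4 and still has length at least 5\<gamma>/8.\<close>

lemma Y0_normal:
  assumes "x \<in> Y0 f"
  obtains y s where "(y, s) \<in> \<Omega>" "P y = 0" "x = y + s *\<^sub>R \<nu> y"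
proof -
  define \<rho> where "\<rho> = \<gamma> / (4 * K)"
  have \<rho>: "0 < \<rho>" "\<rho> \<le> 1 / 8" "K * \<rho> = \<gamma> / 4" "\<rho> < 3 * \<gamma> / (8 * K)"
    using \<gamma>_pos \<gamma>_less K by (auto simp: \<rho>_def divide_simps)
  have x: "norm x \<le> 1 / 2" "f x = 0" "\<gamma> \<le> norm (\<phi> x)"
    using assms zero_norm_le zero_regular by (auto simp: Y0_def)
  then have xb: "x \<in> ball 0 1" by simp
  have \<nu>x: "7 / 8 * \<gamma> \<le> norm (\<nu> x)"
    using grad_near[OF xb] norm_triangle_ineq2[of "\<phi> x" "\<nu> x"] x(3) by linarith
  obtain z where z: "dist x z \<le> \<rho>" "P z = 0" using zero_near_zero[OF assms] unfolding \<rho>_def by blast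
  have "closed {y. P y = 0}" by (intro closed_Collect_eq cont_P continuous_intros)
  moreover have "{y. P y = 0} \<noteq> {}" using z by auto
  ultimately obtain y where y: "P y = 0" "\<And>w. P w = 0 \<Longrightarrow> dist x y \<le> dist x w"
    using distance_attains_inf[of "{y. P y = 0}" x] by auto
  have dist: "dist x y \<le> \<rho>" using y(2)[OF z(2)] z(1) by simp
  have "norm y \<le> norm x + dist x y"
    using norm_triangle_ineq[of x "y - x"] by (simp add: dist_norm norm_minus_commute)
  then have ny: "norm y < 3 / 4" using x(1) dist \<rho>(2) by linarith
  have "norm (\<nu> x - \<nu> y) \<le> K * dist x y"
    using lipschitz_\<nu>[OF xb, of y] ny by (simp add: dist_norm)
  also have "\<dots> \<le> \<gamma> / 4" using mult_left_mono[OF dist, of K] K_pos \<rho>(3) by simp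
  finally have \<nu>y: "5 / 8 * \<gamma> \<le> norm (\<nu> y)"
    using norm_triangle_ineq2[of "\<nu> x" "\<nu> y"] \<nu>x by linarith
  then have \<nu>y': "\<gamma> / 2 < norm (\<nu> y)" using \<gamma>_pos by linarith
  have "\<exists>s. x = y + s *\<^sub>R \<nu> y \<and> \<bar>s\<bar> * norm (\<nu> y) = dist x y"
  proof (cases "x = y")
    case False
    then show ?thesis
      using y \<nu>y' \<gamma>_pos by (intro nearest_zero_normal) (auto simp: not_le[symmetric])
  qed (intro exI[of _ 0], simp)
  then obtain s where "x = y + s *\<^sub>R \<nu> y" "\<bar>s\<bar> * norm (\<nu> y) = dist x y" by blast
  then show ?thesis
    using that[of y s] y(1) ny \<nu>y' dist \<rho>(4) by (simp add: \<Omega>_def)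
qed

end

section \<open>The isotopy and the components\<close>

lemma finite_components_locally_connected:
  assumes "compact S" "locally connected S"
  shows "finite (components S)"
proof -
  have "\<forall>C\<in>components S. openin (top_of_set S) C"
    using openin_components_locally_connected[OF assms(2)] by blast
  moreover have "S \<subseteq> \<Union>(components S)" by (simp add: Union_components)
  ultimately obtain D where D: "D \<subseteq> components S" "finite D" "S \<subseteq> \<Union>D"
    using assms(1) unfolding compact_eq_openin_cover by meson
  have "components S \<subseteq> D"
  proof
    fix C assume C: "C \<in> components S"
    then obtain x where x: "x \<in> C" using in_components_nonempty by blast
    then obtain C' where "C' \<in> D" "x \<in> C'" using D(3) in_components_subset[OF C] by blast
    then have "C = C'" using components_eq[OF C, of C'] D(1) x by blast
    then show "C \<in> D" using \<open>C' \<in> D\<close> by simp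
  qed
  then show ?thesis using D(2) finite_subset by blast
qed

context close_defining_functions
begin

lemma compact_Y0_f: "compact (Y0 f)"
proof -
  have "Y0 f = {x \<in> cball 0 (1 / 2). f x = 0}"
    using zero_norm_le by (auto simp: Y0_def)
  moreover have "continuous_on (cball 0 (1 / 2)) f"
    by (rule continuous_on_subset[OF Ck_on_continuous[OF Ck_f]]) auto
  then have "closed {x \<in> cball 0 (1 / 2). f x = 0}"
    by (rule continuous_closed_preimage_constant) simp
  moreover have "bounded {x \<in> cball 0 (1 / 2). f x = 0}"
    by (rule bounded_subset[OF bounded_cball[of 0 "1 / 2"]]) auto
  ultimately show ?thesis unfolding compact_eq_bounded_closed by simp
qed

definition isotopy :: "real \<Rightarrow> 'a \<Rightarrow> 'a" where
  "isotopy t x = (1 - t) *\<^sub>R x + t *\<^sub>R \<pi> x"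

text \<open>All points of the segment from \<open>x\<close> to its foot have the same foot. Hence
  \<epsilon> after \<pi> recovers \<open>x\<close> at every time and is a common inverse of all the
  embeddings.\<close>

lemma isotopy_Y0:
  assumes "x \<in> Y0 f" "t \<in> {0..1}"
  shows "isotopy t x \<in> cball 0 1" "isotopy t x \<in> N\<^sub>\<pi>" "\<pi> (isotopy t x) \<in> N\<^sub>\<epsilon>" "\<epsilon> (\<pi> (isotopy t x)) = x"
proof -
  obtain y s where ys: "(y, s) \<in> \<Omega>" "P y = 0" "x = y + s *\<^sub>R \<nu> y" using Y0_normal[OF assms(1)] .
  have \<pi>x: "\<pi> x = y" using \<pi>_normal(2)[OF ys(1,2)] ys(3) by simp
  have H: "isotopy t x = y + ((1 - t) * s) *\<^sub>R \<nu> y"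
    unfolding isotopy_def \<pi>x using ys(3) by (simp add: algebra_simps)
  have O: "(y, (1 - t) * s) \<in> \<Omega>"
    by (rule \<Omega>_shrink[OF ys(1)]) (use assms(2) in \<open>simp add: abs_mult mult_left_le_one_le\<close>)
  show "isotopy t x \<in> cball 0 1" using \<Omega>_ball(2)[OF O] H by simp
  show "isotopy t x \<in> N\<^sub>\<pi>" using \<pi>_normal(1)[OF O ys(2)] H by simp
  have "\<pi> (isotopy t x) = y" using \<pi>_normal(2)[OF O ys(2)] H by simp
  moreover have "f (y + s *\<^sub>R \<nu> y) = 0" using assms(1) ys(3) by (simp add: Y0_def)
  note \<epsilon>_normal[OF ys(1) this]
  ultimately show "\<pi> (isotopy t x) \<in> N\<^sub>\<epsilon>" "\<epsilon> (\<pi> (isotopy t x)) = x" using ys(3) by simp_all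
qed

lemma
  assumes "x \<in> Y0 f"
  shows Y0_N\<^sub>\<pi>: "x \<in> N\<^sub>\<pi>" and \<pi>_Y0_N\<^sub>\<epsilon>: "\<pi> x \<in> N\<^sub>\<epsilon>" and \<epsilon>_\<pi>: "\<epsilon> (\<pi> x) = x"
  using isotopy_Y0[OF assms, of 0] by (simp_all add: isotopy_def)

text \<open>Written as a trace of the open set \<open>N\<^sub>\<epsilon>\<close>, the image is
  visibly open in \<open>Y0 P\<close>.\<close>

lemma \<pi>_Y0: "\<pi> ` Y0 f = Y0 P \<inter> N\<^sub>\<epsilon>"
proof (intro equalityI subsetI)
  fix y assume "y \<in> \<pi> ` Y0 f"
  then obtain x where x: "x \<in> Y0 f" "y = \<pi> x" by blast
  obtain s where s: "(\<pi> x, s) \<in> \<Omega>" "P (\<pi> x) = 0" using \<pi>_obtain[OF Y0_N\<^sub>\<pi>[OF x(1)]] .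
  then show "y \<in> Y0 P \<inter> N\<^sub>\<epsilon>" using \<pi>_Y0_N\<^sub>\<epsilon>[OF x(1)] \<Omega>_ball(1)[OF s(1)] x(2) by (simp add: Y0_def)
next
  fix y assume y: "y \<in> Y0 P \<inter> N\<^sub>\<epsilon>"
  then obtain s where s: "(y, s) \<in> \<Omega>" "\<epsilon> y = y + s *\<^sub>R \<nu> y" using \<epsilon>_obtain by blast
  then have "\<pi> (\<epsilon> y) = y" using \<pi>_normal(2)[of y s] y by (simp add: Y0_def)
  then show "y \<in> \<pi> ` Y0 f" using \<epsilon>_in_Y0 y by (metis IntE imageI)
qed

lemma
  assumes "y \<in> N\<^sub>\<epsilon>"
  shows N\<^sub>\<epsilon>_ball: "y \<in> ball 0 1" and N\<^sub>\<epsilon>_gradient: "\<nu> y \<noteq> 0"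
proof -
  obtain s where s: "(y, s) \<in> \<Omega>" using \<epsilon>_obtain[OF assms] .
  then show "y \<in> ball 0 1" "\<nu> y \<noteq> 0" using \<Omega>_ball(1) \<gamma>_pos by (auto simp: \<Omega>_def)
qed

definition N :: "'a set" where "N = N\<^sub>\<pi> \<inter> \<pi> -` N\<^sub>\<epsilon>"

lemma open_N: "open N"
  unfolding N_def by (rule continuous_open_preimage[OF Ck_on_continuous[OF Ck_\<pi>] open_N\<^sub>\<pi> open_N\<^sub>\<epsilon>])

lemma Ck_\<epsilon>_\<pi>: "Ck_on (Suc m) N (\<lambda>x. \<epsilon> (\<pi> x))"
  using Ck_on_compose[OF solid_open[OF open_N] solid_open[OF open_N\<^sub>\<epsilon>] Ck_\<epsilon>
      Ck_on_subset[OF solid_open[OF open_N] _ Ck_\<pi>]]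
  by (auto simp: N_def)

text \<open>A retract of an open set is locally connected. Finiteness of the number of components
  follows without charts on the hypersurface.\<close>

lemma Y0_retract_of: "Y0 f retract_of N"
  unfolding retract_of_def
proof (intro exI)
  show "retraction N (Y0 f) (\<lambda>x. \<epsilon> (\<pi> x))"
    unfolding retraction_def using Ck_on_continuous[OF Ck_\<epsilon>_\<pi>]
    by (auto simp: N_def Y0_N\<^sub>\<pi> \<pi>_Y0_N\<^sub>\<epsilon> \<epsilon>_\<pi> \<epsilon>_in_Y0)
qed

lemma finite_components_Y0: "finite (components (Y0 f))"
  by (rule finite_components_locally_connected[OF compact_Y0_f ENR_imp_locally_connected])
    (use Y0_retract_of open_N in \<open>auto simp: ENR_def\<close>)

lemma continuous_\<pi>_Y0: "S \<subseteq> Y0 f \<Longrightarrow> continuous_on S \<pi>"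
  using continuous_on_subset[OF Ck_on_continuous[OF Ck_\<pi>]] Y0_N\<^sub>\<pi> by blast

lemma inj_\<pi>_Y0: "inj_on \<pi> (Y0 f)"
  by (rule inj_on_inverseI[of _ \<epsilon>]) (rule \<epsilon>_\<pi>)

lemma isotopic: "Ck_isotopic (Suc m) (cball 0 1) (Y0 f) (\<pi> ` Y0 f)"
  unfolding Ck_isotopic_def
proof (intro exI conjI ballI)
  have op: "open (UNIV \<times> N\<^sub>\<pi> :: (real \<times> 'a) set)" by (intro open_Times open_N\<^sub>\<pi> open_UNIV)
  have "Ck_on (Suc m) (UNIV \<times> N\<^sub>\<pi>) (\<lambda>p :: real \<times> 'a. (1 - fst p) *\<^sub>R snd p + fst p *\<^sub>R \<pi> (snd p))"
    by (intro Ck_on_add Ck_on_diff Ck_on_const Ck_on_scaleR solid_open[OF op] Ck_on_linear bounded_linear_fst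
        bounded_linear_snd Ck_on_compose[OF solid_open[OF op] solid_open[OF open_N\<^sub>\<pi>] Ck_\<pi>]) auto
  then show "Ck_map (Suc m) ({0..1} \<times> Y0 f) (\<lambda>(t, x). isotopy t x)"
    unfolding Ck_map_def isotopy_def case_prod_unfold using op Y0_N\<^sub>\<pi> by blast
  fix t :: real assume t: "t \<in> {0..1}"
  show "isotopy t ` Y0 f \<subseteq> cball 0 1" using isotopy_Y0(1)[OF _ t] by blast
  have inj: "inj_on (isotopy t) (Y0 f)"
    by (rule inj_on_inverseI[of _ "\<lambda>z. \<epsilon> (\<pi> z)"]) (rule isotopy_Y0(4)[OF _ t])
  show "Ck_diffeo (Suc m) (isotopy t) (Y0 f) (isotopy t ` Y0 f)"
    unfolding Ck_diffeo_def
  proof (intro conjI)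
    show "bij_betw (isotopy t) (Y0 f) (isotopy t ` Y0 f)" using inj by (simp add: bij_betw_def)
    have "Ck_on (Suc m) N\<^sub>\<pi> (isotopy t)"
      unfolding isotopy_def[abs_def]
      by (intro Ck_on_add Ck_on_scaleR Ck_on_const Ck_on_id solid_open[OF open_N\<^sub>\<pi>] Ck_\<pi>)
    then show "Ck_map (Suc m) (Y0 f) (isotopy t)"
      unfolding Ck_map_def using open_N\<^sub>\<pi> Y0_N\<^sub>\<pi> by blast
    show "Ck_map (Suc m) (isotopy t ` Y0 f) (inv_into (Y0 f) (isotopy t))"
      unfolding Ck_map_def
    \<comment> \<open>The same open set \<open>N\<close> and the same extension serve for every
      \<open>t\<close>.\<close>
    proof (intro exI conjI)
      show "isotopy t ` Y0 f \<subseteq> N" using isotopy_Y0(2,3)[OF _ t] by (auto simp: N_def)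
      show "\<forall>z\<in>isotopy t ` Y0 f. \<epsilon> (\<pi> z) = inv_into (Y0 f) (isotopy t) z"
        using isotopy_Y0(4)[OF _ t] inj by simp
    qed (rule open_N Ck_\<epsilon>_\<pi>)+
  qed
qed (auto simp: isotopy_def)

section \<open>Components of the image\<close>

text \<open>A connected set \<open>D\<close> between the image of \<open>C\<close> and
  \<open>Y0 P\<close> meets \<open>N\<^sub>\<epsilon>\<close> in a relatively open set, which is
  also closed in \<open>D\<close> since the image of \<pi> is compact. So \<open>D\<close> lies in
  \<open>N\<^sub>\<epsilon>\<close>, and \<epsilon> carries it to a connected set containing
  \<open>C\<close>; maximality of \<open>C\<close> gives maximality of the image.\<close>

lemma component_\<pi>:
  assumes C: "C \<in> components (Y0 f)"
  shows "\<pi> ` C \<in> components (Y0 P)"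
  unfolding in_components_maximal
proof (intro conjI allI impI)
  have CV: "C \<subseteq> Y0 f" "C \<noteq> {}" "connected C"
    using C in_components_subset in_components_nonempty in_components_connected by blast+
  then show "\<pi> ` C \<noteq> {}" "\<pi> ` C \<subseteq> Y0 P" using \<pi>_Y0 by auto
  show "connected (\<pi> ` C)" by (rule connected_continuous_image[OF continuous_\<pi>_Y0[OF CV(1)] CV(3)])
  fix D assume D: "D \<noteq> {} \<and> \<pi> ` C \<subseteq> D \<and> D \<subseteq> Y0 P \<and> connected D"
  have eq: "D \<inter> N\<^sub>\<epsilon> = D \<inter> \<pi> ` Y0 f" using D \<pi>_Y0 by auto
  have "compact (\<pi> ` Y0 f)" by (rule compact_continuous_image[OF continuous_\<pi>_Y0 compact_Y0_f]) simp
  then have "closedin (top_of_set D) (D \<inter> N\<^sub>\<epsilon>)"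
    unfolding eq by (intro closedin_closed_Int compact_imp_closed)
  moreover have "openin (top_of_set D) (D \<inter> N\<^sub>\<epsilon>)" by (rule openin_open_Int[OF open_N\<^sub>\<epsilon>])
  ultimately have "D \<inter> N\<^sub>\<epsilon> = {} \<or> D \<inter> N\<^sub>\<epsilon> = D"
    using D unfolding connected_clopen by blast
  moreover have "D \<inter> N\<^sub>\<epsilon> \<noteq> {}"
  proof -
    obtain x where "x \<in> C" using CV(2) by blast
    then have "\<pi> x \<in> D \<inter> N\<^sub>\<epsilon>" using D CV(1) \<pi>_Y0_N\<^sub>\<epsilon> by blast
    then show ?thesis by blast
  qed
  ultimately have DN: "D \<subseteq> N\<^sub>\<epsilon>" by blast
  have max: "A = C" if "A \<noteq> {}" "C \<subseteq> A" "A \<subseteq> Y0 f" "connected A" for A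
    using C that unfolding in_components_maximal by blast
  have "connected (\<epsilon> ` D)"
    by (rule connected_continuous_image[OF continuous_on_subset[OF Ck_on_continuous[OF Ck_\<epsilon>] DN]]) (use D in blast)
  moreover have "C \<subseteq> \<epsilon> ` D"
  proof
    fix x assume "x \<in> C"
    then have "\<pi> x \<in> D" "\<epsilon> (\<pi> x) = x" using D CV(1) \<epsilon>_\<pi> by auto
    then show "x \<in> \<epsilon> ` D" by force
  qed
  moreover have "\<epsilon> ` D \<subseteq> Y0 f" using DN \<epsilon>_in_Y0 by blast
  moreover have "\<epsilon> ` D \<noteq> {}" using D by simp
  ultimately have \<epsilon>D: "\<epsilon> ` D = C" using max by simp
  have "\<pi> (\<epsilon> y) = y" if "y \<in> D" for y
  proof -
    have "y \<in> \<pi> ` Y0 f" using that D DN \<pi>_Y0 by blast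
    then show ?thesis using \<epsilon>_\<pi> by auto
  qed
  then have "\<pi> ` (\<epsilon> ` D) = D" by (simp add: image_image cong: image_cong)
  then show "D = \<pi> ` C" by (simp only: \<epsilon>D)
qed

lemma hypersurface_component:
  assumes C: "C \<in> components (Y0 f)"
  shows "Ck_hypersurface k (\<pi> ` C)"
  unfolding Ck_hypersurface_def
proof
  fix y assume y: "y \<in> \<pi> ` C"
  \<comment> \<open>Removing the finitely many compact images of the other components isolates the
    image of \<open>C\<close>, so P itself is a defining function on \<open>U\<close>.\<close>
  define U where "U = N\<^sub>\<epsilon> - (\<Union>C'\<in>components (Y0 f) - {C}. \<pi> ` C')"
  have sub: "C' \<subseteq> Y0 f" if "C' \<in> components (Y0 f)" for C' using in_components_subset[OF that] .
  have disj: "\<pi> ` C \<inter> \<pi> ` C' = {}" if C': "C' \<in> components (Y0 f) - {C}" for C'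
  proof -
    have "\<pi> ` C \<inter> \<pi> ` C' = \<pi> ` (C \<inter> C')"
      using inj_on_image_Int[OF inj_\<pi>_Y0 sub[OF C], of C'] sub C' by auto
    moreover have "C \<inter> C' = {}" using components_eq[OF C, of C'] C' by auto
    ultimately show ?thesis by simp
  qed
  have "compact (\<pi> ` C')" if "C' \<in> components (Y0 f)" for C'
    by (rule compact_continuous_image[OF continuous_\<pi>_Y0[OF sub[OF that]] compact_components[OF compact_Y0_f that]])
  then have "closed (\<Union>C'\<in>components (Y0 f) - {C}. \<pi> ` C')"
    using finite_components_Y0 by (intro closed_UN) (auto intro: compact_imp_closed)
  then have U: "open U" unfolding U_def by (rule open_Diff[OF open_N\<^sub>\<epsilon>])
  have yU: "y \<in> U" unfolding U_def using y \<pi>_Y0_N\<^sub>\<epsilon> sub[OF C] disj by blast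
  have "z \<in> \<pi> ` C" if "z \<in> U" "P z = 0" for z
  proof -
    have "z \<in> N\<^sub>\<epsilon>" using that(1) by (simp add: U_def)
    then have "z \<in> \<pi> ` Y0 f" using that(2) N\<^sub>\<epsilon>_ball[of z] unfolding \<pi>_Y0 by (simp add: Y0_def)
    then obtain x where x: "x \<in> Y0 f" "z = \<pi> x" by blast
    then obtain C' where "C' \<in> components (Y0 f)" "x \<in> C'" by (metis UnionE Union_components)
    then show ?thesis using that(1) x by (auto simp: U_def)
  qed
  moreover have "P z = 0" if "z \<in> \<pi> ` C" for z using that sub[OF C] \<pi>_Y0 by (force simp: Y0_def)
  ultimately have "\<pi> ` C \<inter> U = {z \<in> U. P z = 0}" by blast
  moreover have "grad_on U P z \<noteq> 0" if "z \<in> U" for z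
    using grad_on_eq[OF solid_open[OF U] that has_derivative_at_withinI[OF dP]] N\<^sub>\<epsilon>_gradient that
    by (simp add: U_def)
  moreover have "Ck_on k U P" by (rule Ck_on_subset[OF solid_open[OF U] subset_UNIV Ck_P])
  ultimately show "\<exists>U g. open U \<and> y \<in> U \<and> Ck_on k U g \<and> \<pi> ` C \<inter> U = {y \<in> U. g y = 0} \<and>
      (\<forall>y\<in>\<pi> ` C \<inter> U. grad_on U g y \<noteq> 0)"
    using U yU by (intro exI[of _ U] exI[of _ P]) auto
qed

lemma hypersurface_Y0: "Ck_hypersurface (Suc m) (Y0 f)"
  unfolding Ck_hypersurface_def
proof
  fix x assume "x \<in> Y0 f"
  have Y: "Y0 f = {y \<in> ball 0 1. f y = 0}"
    using zero_norm_le by (force simp: Y0_def)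
  have "grad_on (ball 0 1) f y \<noteq> 0" if "y \<in> Y0 f" for y
    using grad_on_eq[OF solid_open[OF open_ball], of y 0 1 f "\<phi> y"] has_derivative_at_withinI[OF df, of y]
      zero_regular[of y] \<gamma>_pos that unfolding Y by auto
  then show "\<exists>U g. open U \<and> x \<in> U \<and> Ck_on (Suc m) U g \<and> Y0 f \<inter> U = {y \<in> U. g y = 0} \<and>
      (\<forall>y\<in>Y0 f \<inter> U. grad_on U g y \<noteq> 0)"
    using Ck_f \<open>x \<in> Y0 f\<close> Y by (intro exI[of _ "ball 0 1"] exI[of _ f]) auto
qed

theorem isotopic_components:
  "\<exists>(q::nat) V W. bij_betw V {1..q} (components (Y0 f)) \<and> inj_on W {1..q} \<and>
     (\<forall>i\<in>{1..q}. W i \<in> components (Y0 P) \<and> (\<forall>k. Ck_hypersurface k (W i))) \<and>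
     Ck_isotopic (Suc m) (cball 0 1) (\<Union>i\<in>{1..q}. V i) (\<Union>i\<in>{1..q}. W i)"
proof -
  obtain q V where V: "bij_betw V {1..q::nat} (components (Y0 f))"
    using ex_bij_betw_nat_finite_1[OF finite_components_Y0] by blast
  then have comp: "V i \<in> components (Y0 f)" if "i \<in> {1..q}" for i
    using that bij_betwE by blast
  have "inj_on (\<lambda>i. \<pi> ` V i) {1..q}"
  proof (rule inj_onI)
    fix i j assume ij: "i \<in> {1..q}" "j \<in> {1..q}" "\<pi> ` V i = \<pi> ` V j"
    then have "V i = V j"
      using inj_on_image_eq_iff[OF inj_\<pi>_Y0] in_components_subset[OF comp] by blast
    then show "i = j" using V ij unfolding bij_betw_def inj_on_def by blast
  qed
  moreover have Un: "(\<Union>i\<in>{1..q}. V i) = Y0 f"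
    using V Union_components[of "Y0 f"] unfolding bij_betw_def by simp
  moreover have "(\<Union>i\<in>{1..q}. \<pi> ` V i) = \<pi> ` Y0 f"
    unfolding Un[symmetric] by blast
  ultimately show ?thesis
    using V comp component_\<pi> hypersurface_component isotopic
    by (intro exI[of _ q] exI[of _ V] exI[of _ "\<lambda>i. \<pi> ` V i"]) auto
qed

end

section \<open>From the bound on the derivative of order d + 1 to the closeness estimates\<close>

lemma has_derivative_grad_on:
  assumes "g differentiable_on S" "x \<in> S"
  shows "(g has_derivative (\<lambda>h. grad_on S g x \<bullet> h)) (at x within S)"
proof -
  have "(\<Sum>b\<in>Basis. (h \<bullet> b) *\<^sub>R partial_deriv S b g x) = grad_on S g x \<bullet> h" for h
    by (simp add: grad_on_def inner_sum_left inner_commute[of h] mult.commute)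
  then show ?thesis using has_derivative_partial[OF assms] by simp
qed

theorem theorem7p1:
  fixes f :: "real ^ 'n::finite \<Rightarrow> real"
    and d :: nat
    and \<gamma> C :: real
  assumes "d \<ge> 1"
    and "poly_deriv_bound TYPE('n) d C"
    and "Ck_on (d + 1) (cball 0 1) f"
    and "M 0 f = 1"
    and "\<forall>x\<in>cball 0 1 - cball 0 (1/2). f x \<noteq> 0"
    and "0 < \<gamma>" and "\<gamma> < 1"
    and "regular_value \<gamma> f 0"
    and "M (d + 1) f \<le> min 1 (fact d * \<gamma>\<^sup>2 / (4 * C3 d C))"
  shows "Ck_hypersurface (d + 1) (Y0 f) \<and>
    (\<exists>(q::nat) V W.
       bij_betw V {1..q} (components (Y0 f)) \<and>
       inj_on W {1..q} \<and>
       (\<forall>i\<in>{1..q}. W i \<in> components (Y0 (taylor_poly d f)) \<and> (\<forall>k. Ck_hypersurface k (W i))) \<and>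
       Ck_isotopic (d + 1) (cball 0 1) (\<Union>i\<in>{1..q}. V i) (\<Union>i\<in>{1..q}. W i))"
proof -
  have d: "d \<ge> 1" and C: "poly_deriv_bound TYPE('n) d C" and f: "Ck_on (Suc d) (cball 0 1) f"
    and M0: "M 0 f = 1" and MT: "M (Suc d) f \<le> min 1 (fact d * \<gamma>\<^sup>2 / (4 * C3 d C))"
    using assms by simp_all
  define K where "K = C3 d C"
  have K: "2 \<le> K"
  proof -
    have C1: "1 \<le> C" by (rule poly_deriv_bound_ge_1[OF C d])
    then have "0 \<le> C / fact (d + 1)" by simp
    with C1 show ?thesis unfolding K_def C3_def C1_def C2_def by linarith
  qed
  have fB: "Ck_on (Suc d) (ball 0 1) f" by (rule Ck_on_unit_ball[OF f])
  define P where "P = taylor_poly d f"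
  have U: "solid (UNIV :: (real ^ 'n) set)" by (simp add: solid_open)
  have CkP: "Ck_on j UNIV P" for j unfolding P_def by (rule Ck_on_taylor_poly[OF U])
  let ?p = "partial_deriv (UNIV :: (real ^ 'n) set)"
  define \<nu> where "\<nu> = grad_on UNIV P"
  define \<phi> where "\<phi> = grad_on (ball 0 1) f"
  define \<nu>' where "\<nu>' x h = (\<Sum>b\<in>Basis. (\<Sum>c\<in>Basis. (h \<bullet> c) *\<^sub>R ?p c (?p b P) x) *\<^sub>R b)" for x h :: "real ^ 'n"
  \<comment> \<open>Dividing the bound T by d! gives \<gamma>^2/(4K). For the gradients, \<gamma> <
    1 and K at least 2 reduce this to \<gamma>/8; for the values, the extra divisor d + 1, at least
    2, doubles the denominator.\<close>
  have MT': "M (Suc d) f / fact (Suc d) \<le> \<gamma>\<^sup>2 / (8 * K)" "M (Suc d) f / fact d \<le> \<gamma> / 8"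
  proof -
    have M: "M (Suc d) f / fact d \<le> \<gamma>\<^sup>2 / (4 * K)"
      using divide_right_mono[of "M (Suc d) f" "fact d * \<gamma>\<^sup>2 / (4 * K)" "fact d"] MT
      by (simp add: K_def)
    have "\<gamma>\<^sup>2 / (4 * K) \<le> \<gamma> / 8"
    proof -
      have "\<gamma>\<^sup>2 \<le> \<gamma> * 1" unfolding power2_eq_square using assms(6,7) by (intro mult_left_mono) auto
      also have "\<dots> \<le> \<gamma> / 8 * (4 * K)" using mult_left_mono[OF K, of \<gamma>] assms(6) by simp
      finally show ?thesis using K by (simp add: pos_divide_le_eq mult.commute)
    qed
    with M show "M (Suc d) f / fact d \<le> \<gamma> / 8" by linarith
    have "M (Suc d) f / fact (Suc d) = M (Suc d) f / fact d / Suc d" by simp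
    also have "\<dots> \<le> \<gamma>\<^sup>2 / (4 * K) / Suc d" by (rule divide_right_mono[OF M]) simp
    also have "\<dots> \<le> \<gamma>\<^sup>2 / (4 * K) / 2"
      using d K by (intro divide_left_mono) auto
    finally show "M (Suc d) f / fact (Suc d) \<le> \<gamma>\<^sup>2 / (8 * K)" by simp
  qed
  interpret close_defining_functions f P \<phi> \<nu> \<nu>' \<gamma> K d
  proof
    show "2 \<le> K" "0 < \<gamma>" "\<gamma> < 1" "Ck_on (Suc d) (ball 0 1) f" "\<And>j. Ck_on j UNIV P" by fact+
    show "Ck_on j UNIV \<nu>" for j
      unfolding \<nu>_def grad_on_def[abs_def] using CkP[of "Suc j"]
      by (auto intro!: Ck_on_sum Ck_on_scaleR Ck_on_const U)
    show "(P has_derivative (\<lambda>h. \<nu> x \<bullet> h)) (at x)" for x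
      unfolding \<nu>_def using has_derivative_grad_on[of P UNIV x] CkP[of "Suc 0"] by simp
    show "(f has_derivative (\<lambda>h. \<phi> x \<bullet> h)) (at x)" if "x \<in> ball 0 1" for x
      unfolding \<phi>_def using has_derivative_grad_on[of f "ball 0 1" x] fB that
      by (simp add: at_within_open[OF that])
    show "(\<nu> has_derivative \<nu>' x) (at x)" for x
    proof -
      have "?p b P differentiable_on UNIV" if "b \<in> Basis" for b
        using CkP[of "Suc (Suc 0)"] that by simp
      from has_derivative_partial[OF this UNIV_I] show ?thesis
        unfolding \<nu>_def \<nu>'_def[abs_def] grad_on_def[abs_def]
        by (intro has_derivative_sum bounded_linear.has_derivative[OF bounded_linear_scaleR_left]) auto
    qed
    show "norm (\<nu>' x h) \<le> K * norm h" if x: "x \<in> ball 0 1" for x h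
    proof -
      \<comment> \<open>The operator norm of the Hessian is estimated by the sum of the absolute
        values of its entries, the quantity that \<open>taylor_poly_hessian_bound\<close>
        controls.\<close>
      have "norm (\<nu>' x h) \<le> (\<Sum>b\<in>Basis. \<Sum>c\<in>Basis. norm h * \<bar>?p c (?p b P) x\<bar>)"
        unfolding \<nu>'_def
      proof (intro order_trans[OF norm_sum sum_mono])
        fix b :: "real ^ 'n" assume b: "b \<in> Basis"
        have "norm ((\<Sum>c\<in>Basis. (h \<bullet> c) *\<^sub>R ?p c (?p b P) x) *\<^sub>R b) = \<bar>\<Sum>c\<in>Basis. (h \<bullet> c) * ?p c (?p b P) x\<bar>"
          using b by simp
        also have "\<dots> \<le> (\<Sum>c\<in>Basis. norm h * \<bar>?p c (?p b P) x\<bar>)"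
          by (intro order_trans[OF sum_abs sum_mono]) (auto simp: abs_mult intro!: mult_right_mono Basis_le_norm)
        finally show "norm ((\<Sum>c\<in>Basis. (h \<bullet> c) *\<^sub>R ?p c (?p b P) x) *\<^sub>R b)
            \<le> (\<Sum>c\<in>Basis. norm h * \<bar>?p c (?p b P) x\<bar>)" .
      qed
      also have "\<dots> = norm h * (\<Sum>bs\<in>multi_dirs (Suc (Suc 0)). \<bar>iter_partial UNIV bs P x\<bar>)"
        unfolding sum_multi_dirs_Cons by (subst sum.swap) (simp add: sum_distrib_left)
      also have "\<dots> \<le> norm h * K"
        unfolding P_def K_def using MT x
        by (intro mult_left_mono taylor_poly_hessian_bound[OF f C d M0]) auto
      finally show ?thesis by (simp add: mult.commute)
    qed
    show "\<bar>f x - P x\<bar> \<le> \<gamma>\<^sup>2 / (8 * K)" if "x \<in> ball 0 1" for x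
      using abs_diff_taylor_poly_le[OF f that] MT'(1) unfolding P_def by linarith
    show "norm (\<phi> x - \<nu> x) \<le> \<gamma> / 8" if x: "x \<in> ball 0 1" for x
    proof -
      obtain e where "d = Suc e" using d by (cases d) auto
      from norm_gradient_diff_taylor_poly_le[OF f x this] MT'(2)
      show ?thesis unfolding \<phi>_def \<nu>_def P_def by linarith
    qed
    show half: "norm x \<le> 1 / 2" if "x \<in> cball 0 1" "f x = 0" for x
      using assms(5) that by auto
    show "\<gamma> \<le> norm (\<phi> x)" if x: "x \<in> cball 0 1" "f x = 0" for x
    proof -
      \<comment> \<open>Regularity is stated for the gradient relative to the closed ball; zeros of
        f are interior points, where it equals the gradient on the open ball.\<close>
      have "x \<in> ball 0 1" using half[OF x] by simp
      then have "partial_deriv (ball 0 1) b f x = partial_deriv (cball 0 1) b f x" if "b \<in> Basis" for b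
        using f that by (intro partial_deriv_subset) (auto simp: solid_open)
      then have "\<phi> x = grad_on (cball 0 1) f x" by (simp add: \<phi>_def grad_on_def)
      then show ?thesis using assms(8) x unfolding regular_value_def by simp
    qed
  qed
  show ?thesis
    using hypersurface_Y0 isotopic_components unfolding P_def by simp
qed

end
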